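(* Let $G$ be a (Gromov) hyperbolic group and let $H\le G$ be a subgroup. (a) Suppose that $H$ is quasiconvex in $G$ and either virtually cyclic or almost malnormal. Then the extension problem is solvable for $H\le G$. (b) Conversely, if the extension problem is solvable for $H\le G$, then $H$ is quasiconvex in $G$.
   Context: A subgroup $H$ of a group $G$ is almost malnormal if $|H\cap g^{-1}Hg|<\infty$ for all $g\in G\setminus H$. All group actions on metric spaces are by isometries. Let a group $H$ act on metric spaces $(R,d_R)$ and $(S,d_S)$. A map $f\colon R\to S$ is coarsely $H$-equivariant if for every $x\in R$ we have $\sup_{h\in H} d_S(f(hx),hf(x))<\infty$. It is a quasi-isometric embedding if there is a constant $C$ such that $\frac1C d_R(x,y)-C\le d_S(f(x),f(y))\le C d_R(x,y)+C$ for all $x,y\in R$. Let $H\le G$ and let $H$ act on a metric space $R$. An action of $G$ on a (possibly different) metric space $S$ is an extension of the action of $H$ on $R$ if there exists a coarsely $H$-equivariant quasi-isometric embedding $R\to S$. The extension problem is solvable for $H\le G$ if every action of $H$ on a metric space has an extension to an action of $G$ on some metric space. *)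

theory Defs
  imports "HOL-Algebra.Group_Action" "HOL-Algebra.Elementary_Groups" "HOL-Analysis.Abstract_Metric_Spaces"
begin

section \<open>Word metrics, hyperbolic groups, and types of subgroups\<close>

definition finite_generating_set :: "('g, 'm) monoid_scheme \<Rightarrow> 'g set \<Rightarrow> bool" where
  "finite_generating_set G X \<longleftrightarrow> finite X \<and> X \<subseteq> carrier G \<and> generate G X = carrier G"

definition word_length :: "('g, 'm) monoid_scheme \<Rightarrow> 'g set \<Rightarrow> 'g \<Rightarrow> nat" where
  "word_length G X g =
     (LEAST n. \<exists>ws. length ws = n \<and> set ws \<subseteq> X \<union> (\<lambda>x. inv\<^bsub>G\<^esub> x) ` X \<and>
                    foldr (\<lambda>a b. a \<otimes>\<^bsub>G\<^esub> b) ws \<one>\<^bsub>G\<^esub> = g)"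

text \<open>The word metric, i.e. the metric induced on the vertex set of the Cayley graph.
  It is only used for generating sets \<open>X\<close>.\<close>

definition word_dist :: "('g, 'm) monoid_scheme \<Rightarrow> 'g set \<Rightarrow> 'g \<Rightarrow> 'g \<Rightarrow> real" where
  "word_dist G X x y = real (word_length G X (inv\<^bsub>G\<^esub> x \<otimes>\<^bsub>G\<^esub> y))"

definition gromov_product :: "('a \<Rightarrow> 'a \<Rightarrow> real) \<Rightarrow> 'a \<Rightarrow> 'a \<Rightarrow> 'a \<Rightarrow> real" where
  "gromov_product d w x y = (d x w + d y w - d x y) / 2"

text \<open>Gromov's definition, which makes sense in any metric space; for a group with its word
  metric, hyperbolicity of the group and of its geometric Cayley graph are equivalent.\<close>

definition gromov_hyperbolic :: "'a set \<Rightarrow> ('a \<Rightarrow> 'a \<Rightarrow> real) \<Rightarrow> bool" where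
  "gromov_hyperbolic M d \<longleftrightarrow>
     (\<exists>\<delta>. \<forall>w\<in>M. \<forall>x\<in>M. \<forall>y\<in>M. \<forall>z\<in>M.
        gromov_product d w x z \<ge> min (gromov_product d w x y) (gromov_product d w y z) - \<delta>)"

definition hyperbolic_group :: "('g, 'm) monoid_scheme \<Rightarrow> bool" where
  "hyperbolic_group G \<longleftrightarrow>
     group G \<and> (\<exists>X. finite_generating_set G X \<and> gromov_hyperbolic (carrier G) (word_dist G X))"

text \<open>Geodesic edge paths \<open>p 0, \<dots>, p n\<close> in the Cayley graph, given by their vertices.\<close>

definition cayley_geodesic ::
  "('g, 'm) monoid_scheme \<Rightarrow> 'g set \<Rightarrow> nat \<Rightarrow> (nat \<Rightarrow> 'g) \<Rightarrow> bool" where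
  "cayley_geodesic G X n p \<longleftrightarrow>
     (\<forall>i\<le>n. p i \<in> carrier G) \<and>
     (\<forall>i\<le>n. \<forall>j\<le>n. word_dist G X (p i) (p j) = \<bar>real i - real j\<bar>)"

text \<open>As for hyperbolicity, the finite generating set is existentially quantified; in a
  hyperbolic group quasiconvexity does not depend on it.\<close>

definition quasiconvex_subgroup :: "('g, 'm) monoid_scheme \<Rightarrow> 'g set \<Rightarrow> bool" where
  "quasiconvex_subgroup G H \<longleftrightarrow>
     subgroup H G \<and>
     (\<exists>X. finite_generating_set G X \<and>
        (\<exists>K. \<forall>n p. cayley_geodesic G X n p \<and> p 0 \<in> H \<and> p n \<in> H \<longrightarrow>
                (\<forall>i\<le>n. \<exists>h\<in>H. word_dist G X (p i) h \<le> K)))"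

definition virtually_cyclic :: "('g, 'm) monoid_scheme \<Rightarrow> bool" where
  "virtually_cyclic G \<longleftrightarrow>
     (\<exists>C. subgroup C G \<and> cyclic_group (G\<lparr>carrier := C\<rparr>) \<and> finite (rcosets\<^bsub>G\<^esub> C))"

definition almost_malnormal :: "('g, 'm) monoid_scheme \<Rightarrow> 'g set \<Rightarrow> bool" where
  "almost_malnormal G H \<longleftrightarrow>
     subgroup H G \<and>
     (\<forall>g \<in> carrier G - H. finite (H \<inter> (inv\<^bsub>G\<^esub> g <#\<^bsub>G\<^esub> H #>\<^bsub>G\<^esub> g)))"


section \<open>Extending group actions on metric spaces\<close>

definition isometric_action ::
  "('g, 'm) monoid_scheme \<Rightarrow> 'a set \<Rightarrow> ('a \<Rightarrow> 'a \<Rightarrow> real) \<Rightarrow> ('g \<Rightarrow> 'a \<Rightarrow> 'a) \<Rightarrow> bool" where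
  "isometric_action G M d \<phi> \<longleftrightarrow>
     Metric_space M d \<and> group_action G M \<phi> \<and>
     (\<forall>g \<in> carrier G. \<forall>x\<in>M. \<forall>y\<in>M. d (\<phi> g x) (\<phi> g y) = d x y)"

text \<open>The condition \<open>C > 0\<close> is implicit in the usual definition; it cannot be dropped because
  \<open>1 / 0 = 0\<close>.\<close>

definition quasi_isometric_embedding ::
  "'r set \<Rightarrow> ('r \<Rightarrow> 'r \<Rightarrow> real) \<Rightarrow> 's set \<Rightarrow> ('s \<Rightarrow> 's \<Rightarrow> real) \<Rightarrow> ('r \<Rightarrow> 's) \<Rightarrow> bool" where
  "quasi_isometric_embedding R dR S dS f \<longleftrightarrow>
     f \<in> R \<rightarrow> S \<and>
     (\<exists>C>0. \<forall>x\<in>R. \<forall>y\<in>R. 1 / C * dR x y - C \<le> dS (f x) (f y) \<and> dS (f x) (f y) \<le> C * dR x y + C)"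

definition coarsely_equivariant ::
  "'g set \<Rightarrow> 'r set \<Rightarrow> ('g \<Rightarrow> 'r \<Rightarrow> 'r) \<Rightarrow> ('s \<Rightarrow> 's \<Rightarrow> real) \<Rightarrow> ('g \<Rightarrow> 's \<Rightarrow> 's) \<Rightarrow> ('r \<Rightarrow> 's) \<Rightarrow> bool" where
  "coarsely_equivariant H R \<phi> dS \<psi> f \<longleftrightarrow>
     (\<forall>x\<in>R. bdd_above ((\<lambda>h. dS (f (\<phi> h x)) (\<psi> h (f x))) ` H))"

definition is_extension ::
  "('g, 'm) monoid_scheme \<Rightarrow> 'g set \<Rightarrow>
   'r set \<Rightarrow> ('r \<Rightarrow> 'r \<Rightarrow> real) \<Rightarrow> ('g \<Rightarrow> 'r \<Rightarrow> 'r) \<Rightarrow>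
   's set \<Rightarrow> ('s \<Rightarrow> 's \<Rightarrow> real) \<Rightarrow> ('g \<Rightarrow> 's \<Rightarrow> 's) \<Rightarrow> bool" where
  "is_extension G H R dR \<phi> S dS \<psi> \<longleftrightarrow>
     isometric_action G S dS \<psi> \<and>
     (\<exists>f. quasi_isometric_embedding R dR S dS f \<and> coarsely_equivariant H R \<phi> dS \<psi> f)"

text \<open>
  HOL does not quantify over types inside a formula, so the type \<open>'r\<close> that carries the metric
  spaces \<open>R\<close> (arbitrary subsets of \<open>'r\<close> with arbitrary metrics) is an explicit parameter.
  Carrying \<open>S\<close> by \<open>'g \<times> 'r\<close> is no restriction: by \<open>is_extension_resize\<close> below, an extension on
  a metric space over any type gives one over \<open>'g \<times> 'r\<close>. Solvability becomes stronger as the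
  type \<open>'r\<close> grows (\<open>extension_problem_solvable_mono\<close>); hence as a conclusion it should be
  stated for arbitrary \<open>'r\<close>, and as a hypothesis it may be stated for one fixed type, the
  hypothesis ``for all metric spaces'' being at least as strong.
\<close>

definition extension_problem_solvable ::
  "'r itself \<Rightarrow> ('g, 'm) monoid_scheme \<Rightarrow> 'g set \<Rightarrow> bool" where
  "extension_problem_solvable (_ :: 'r itself) G H \<longleftrightarrow>
     (\<forall>(R :: 'r set) dR \<phi>. isometric_action (G\<lparr>carrier := H\<rparr>) R dR \<phi> \<longrightarrow>
        (\<exists>(S :: ('g \<times> 'r) set) dS \<psi>. is_extension G H R dR \<phi> S dS \<psi>))"


section \<open>Independence of the choice of types\<close>

lemma isometric_action_pullback:
  fixes u :: "'b \<Rightarrow> 'a"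
  assumes act: "isometric_action G M d \<phi>"
    and inj: "inj_on u N" and sub: "u ` N \<subseteq> M"
    and inv: "\<And>g x. g \<in> carrier G \<Longrightarrow> x \<in> N \<Longrightarrow> \<phi> g (u x) \<in> u ` N"
  shows "isometric_action G N (\<lambda>x y. d (u x) (u y))
           (\<lambda>g. \<lambda>x\<in>N. inv_into N u (\<phi> g (u x)))" (is "isometric_action G N ?d ?\<phi>")
proof -
  interpret M: Metric_space M d using act by (simp add: isometric_action_def)
  interpret A: group_action G M \<phi> using act by (simp add: isometric_action_def)
  interpret G: group G using A.group_hom by (simp add: group_hom_def)
  have isom: "d (\<phi> g x) (\<phi> g y) = d x y" if "g \<in> carrier G" "x \<in> M" "y \<in> M" for g x y
    using act that by (simp add: isometric_action_def)
  have u: "u (?\<phi> g x) = \<phi> g (u x)" if "g \<in> carrier G" "x \<in> N" for g x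
    using that inv[OF that] by (simp add: f_inv_into_f)
  have cl: "?\<phi> g x \<in> N" if "g \<in> carrier G" "x \<in> N" for g x
    using that inv[OF that] by (simp add: inv_into_into)
  have uM: "u x \<in> M" if "x \<in> N" for x
    using that sub by blast
  have comp: "?\<phi> (g \<otimes>\<^bsub>G\<^esub> h) x = ?\<phi> g (?\<phi> h x)"
    if "g \<in> carrier G" "h \<in> carrier G" "x \<in> N" for g h x
  proof (rule inj_onD[OF inj])
    show "u (?\<phi> (g \<otimes>\<^bsub>G\<^esub> h) x) = u (?\<phi> g (?\<phi> h x))"
      using that u[of "g \<otimes>\<^bsub>G\<^esub> h" x] u[of g "?\<phi> h x"] u[of h x] cl[of h x] uM[of x]
      by (simp only: G.m_closed A.composition_rule)
  qed (use that in \<open>blast intro: cl G.m_closed\<close>)+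
  have one: "?\<phi> \<one>\<^bsub>G\<^esub> x = x" if "x \<in> N" for x
  proof -
    have "\<phi> \<one>\<^bsub>G\<^esub> (u x) = u x"
      using A.id_eq_one uM[OF that] by (metis restrict_apply')
    then show ?thesis
      using that inj by simp
  qed
  have bij: "?\<phi> g \<in> Bij N" if g: "g \<in> carrier G" for g
  proof -
    have "bij_betw (?\<phi> g) N N"
    proof (rule bij_betw_byWitness[where f' = "?\<phi> (inv\<^bsub>G\<^esub> g)"])
      show "\<forall>a\<in>N. ?\<phi> (inv\<^bsub>G\<^esub> g) (?\<phi> g a) = a"
        using comp[of "inv\<^bsub>G\<^esub> g" g] one g by (metis G.inv_closed G.l_inv)
      show "\<forall>a\<in>N. ?\<phi> g (?\<phi> (inv\<^bsub>G\<^esub> g) a) = a"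
        using comp[of g "inv\<^bsub>G\<^esub> g"] one g by (metis G.inv_closed G.r_inv)
      show "?\<phi> g ` N \<subseteq> N"
        using cl[OF g] by blast
      show "?\<phi> (inv\<^bsub>G\<^esub> g) ` N \<subseteq> N"
        using cl[OF G.inv_closed[OF g]] by blast
    qed
    then show ?thesis
      by (simp add: Bij_def)
  qed
  have "?\<phi> \<in> hom G (BijGroup N)"
  proof (rule homI)
    fix g h assume gh: "g \<in> carrier G" "h \<in> carrier G"
    have "?\<phi> (g \<otimes>\<^bsub>G\<^esub> h) = compose N (?\<phi> g) (?\<phi> h)"
    proof
      fix x
      show "?\<phi> (g \<otimes>\<^bsub>G\<^esub> h) x = compose N (?\<phi> g) (?\<phi> h) x"
        using comp[OF gh, of x] by (cases "x \<in> N") (auto simp: compose_def)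
    qed
    then show "?\<phi> (g \<otimes>\<^bsub>G\<^esub> h) = ?\<phi> g \<otimes>\<^bsub>BijGroup N\<^esub> ?\<phi> h"
      using bij gh by (simp add: BijGroup_def)
  qed (use bij in \<open>simp add: BijGroup_def\<close>)
  then have "group_action G N ?\<phi>"
    by (simp add: group_action_def group_hom_def group_hom_axioms_def group_BijGroup)
  moreover have "Metric_space N ?d"
    using inj uM by unfold_locales (auto simp: M.commute M.triangle inj_on_eq_iff)
  moreover have "?d (?\<phi> g x) (?\<phi> g y) = ?d x y" if "g \<in> carrier G" "x \<in> N" "y \<in> N" for g x y
    using that u[of g x] u[of g y] isom[of g "u x" "u y"] uM by simp
  ultimately show ?thesis
    by (simp add: isometric_action_def)
qed

lemma is_extension_resize:
  fixes G :: "('g, 'm) monoid_scheme" and R :: "'r set" and S :: "'s set"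
  assumes H: "H \<subseteq> carrier G" and ext: "is_extension G H R dR \<phi> S dS \<psi>"
    and R: "\<And>h x. h \<in> H \<Longrightarrow> x \<in> R \<Longrightarrow> \<phi> h x \<in> R"
  shows "\<exists>(S' :: ('g \<times> 'r) set) dS' \<psi>'. is_extension G H R dR \<phi> S' dS' \<psi>'"
proof -
  obtain f C where act: "isometric_action G S dS \<psi>" and f: "f \<in> R \<rightarrow> S" and C: "C > 0"
    and qi: "\<And>x y. x \<in> R \<Longrightarrow> y \<in> R \<Longrightarrow>
       1 / C * dR x y - C \<le> dS (f x) (f y) \<and> dS (f x) (f y) \<le> C * dR x y + C"
    and eqv: "coarsely_equivariant H R \<phi> dS \<psi> f"
    using ext unfolding is_extension_def quasi_isometric_embedding_def by blast
  interpret A: group_action G S \<psi> using act by (simp add: isometric_action_def)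
  interpret G: group G using A.group_hom by (simp add: group_hom_def)
  define u where "u = (\<lambda>(g, x). \<psi> g (f x))"
  obtain N where N: "N \<subseteq> carrier G \<times> R" "inj_on u N" "u ` (carrier G \<times> R) = u ` N"
    using subset_image_inj[of "u ` (carrier G \<times> R)" u "carrier G \<times> R"] by blast
  have sub: "u ` N \<subseteq> S"
    unfolding N(3)[symmetric] using A.element_image[OF _ funcset_mem[OF f]] by (auto simp: u_def)
  have inv: "\<psi> g (u z) \<in> u ` N" if g: "g \<in> carrier G" and z: "z \<in> N" for g z
  proof -
    obtain k x where kx: "z = (k, x)" "k \<in> carrier G" "x \<in> R"
      using z N(1) by auto
    then have "\<psi> g (u z) = u (g \<otimes>\<^bsub>G\<^esub> k, x)"
      using g A.composition_rule[OF funcset_mem[OF f kx(3)] g kx(2)] by (simp add: u_def)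
    then show ?thesis
      using N(3) kx g by blast
  qed
  let ?d = "\<lambda>x y. dS (u x) (u y)"
  let ?\<psi> = "\<lambda>g. \<lambda>x\<in>N. inv_into N u (\<psi> g (u x))"
  let ?f = "\<lambda>x. inv_into N u (f x)"
  have fN: "f x \<in> u ` N" if "x \<in> R" for x
  proof -
    have "f x = u (\<one>\<^bsub>G\<^esub>, x)"
      using funcset_mem[OF f that] A.id_eq_one by (simp add: u_def) (metis restrict_apply')
    then show ?thesis
      using N(3) that by blast
  qed
  have uf: "u (?f x) = f x" and fin: "?f x \<in> N" if "x \<in> R" for x
    using fN[OF that] by (simp_all add: f_inv_into_f inv_into_into)
  have "isometric_action G N ?d ?\<psi>"
    by (rule isometric_action_pullback[OF act N(2) sub inv])
  moreover have "quasi_isometric_embedding R dR N ?d ?f"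
    unfolding quasi_isometric_embedding_def using fin C qi by (auto simp: uf)
  moreover have "coarsely_equivariant H R \<phi> ?d ?\<psi> ?f"
    unfolding coarsely_equivariant_def
  proof
    fix x assume x: "x \<in> R"
    have "u (?\<psi> h (?f x)) = \<psi> h (f x)" if "h \<in> H" for h
      using inv[of h "?f x"] H that fin[OF x] by (auto simp: uf[OF x] f_inv_into_f)
    then have "(\<lambda>h. ?d (?f (\<phi> h x)) (?\<psi> h (?f x))) ` H = (\<lambda>h. dS (f (\<phi> h x)) (\<psi> h (f x))) ` H"
      using R x uf by (intro image_cong) simp_all
    then show "bdd_above ((\<lambda>h. ?d (?f (\<phi> h x)) (?\<psi> h (?f x))) ` H)"
      using eqv x by (simp add: coarsely_equivariant_def)
  qed
  ultimately show ?thesis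
    unfolding is_extension_def by blast
qed

lemma extension_problem_solvable_mono:
  fixes G :: "('g, 'm) monoid_scheme" and e :: "'a \<Rightarrow> 'b"
  assumes e: "inj e" and H: "H \<subseteq> carrier G"
    and solv: "extension_problem_solvable TYPE('b) G H"
  shows "extension_problem_solvable TYPE('a) G H"
  unfolding extension_problem_solvable_def
proof (intro allI impI)
  fix R :: "'a set" and dR \<phi>
  assume act: "isometric_action (G\<lparr>carrier := H\<rparr>) R dR \<phi>"
  interpret A: group_action "G\<lparr>carrier := H\<rparr>" R \<phi> using act by (simp add: isometric_action_def)
  have R: "\<phi> h x \<in> R" if "h \<in> H" "x \<in> R" for h x
    using A.element_image[of h x] that by simp
  let ?u = "inv_into UNIV e"
  let ?d = "\<lambda>x y. dR (?u x) (?u y)"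
  let ?\<phi> = "\<lambda>h. \<lambda>x\<in>e ` R. inv_into (e ` R) ?u (\<phi> h (?u x))"
  have ue: "?u (e x) = x" for x
    using e by simp
  have im: "?u ` e ` R = R"
    by (simp add: image_image ue)
  have inj: "inj_on ?u (e ` R)"
    by (rule inj_onI) (metis imageE ue)
  have "isometric_action (G\<lparr>carrier := H\<rparr>) (e ` R) ?d ?\<phi>"
  proof (rule isometric_action_pullback[OF act inj])
    show "?u ` e ` R \<subseteq> R"
      by (simp only: im order_refl)
    show "\<phi> h (?u y) \<in> ?u ` e ` R" if h: "h \<in> carrier (G\<lparr>carrier := H\<rparr>)" and y: "y \<in> e ` R" for h y
    proof -
      obtain x where "x \<in> R" "y = e x" using y by blast
      moreover have "h \<in> H" using h by simp
      ultimately show ?thesis unfolding im by (simp only: ue R)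
    qed
  qed
  then obtain S :: "('g \<times> 'b) set" and dS \<psi> where
    "is_extension G H (e ` R) ?d ?\<phi> S dS \<psi>"
    using solv unfolding extension_problem_solvable_def by blast
  then obtain f where S: "isometric_action G S dS \<psi>"
    and qi: "quasi_isometric_embedding (e ` R) ?d S dS f"
    and eqv: "coarsely_equivariant H (e ` R) ?\<phi> dS \<psi> f"
    unfolding is_extension_def by blast
  have \<phi>: "?\<phi> h (e x) = e (\<phi> h x)" if "h \<in> H" "x \<in> R" for h x
    using R[OF that] that inv_into_f_f[OF inj, of "e (\<phi> h x)"] by (simp add: ue)
  have "quasi_isometric_embedding R dR S dS (f \<circ> e)"
    using qi by (auto simp: quasi_isometric_embedding_def ue)
  moreover have "coarsely_equivariant H R \<phi> dS \<psi> (f \<circ> e)"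
    unfolding coarsely_equivariant_def
  proof
    fix x assume x: "x \<in> R"
    have "(\<lambda>h. dS (f (?\<phi> h (e x))) (\<psi> h (f (e x)))) ` H
        = (\<lambda>h. dS ((f \<circ> e) (\<phi> h x)) (\<psi> h ((f \<circ> e) x))) ` H"
      using x \<phi> by (intro image_cong) simp_all
    then show "bdd_above ((\<lambda>h. dS ((f \<circ> e) (\<phi> h x)) (\<psi> h ((f \<circ> e) x))) ` H)"
      using bspec[OF eqv[unfolded coarsely_equivariant_def] imageI[OF x]] by (simp only:)
  qed
  ultimately have "is_extension G H R dR \<phi> S dS \<psi>"
    using S unfolding is_extension_def by blast
  then show "\<exists>(S :: ('g \<times> 'a) set) dS \<psi>. is_extension G H R dR \<phi> S dS \<psi>"
    by (rule is_extension_resize[OF H]) (rule R)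
qed

end

theory Submission
  imports Defs "HOL-Real_Asymp.Real_Asymp"
begin

text \<open>
  Both directions go through undistortedness: every \<open>h \<in> H\<close> is a product of \<open>O(|h|)\<close> elements of \<open>H\<close>
  of bounded length. This does not depend on the finite generating set, and in a hyperbolic group it
  is equivalent to quasiconvexity by the Morse lemma.

  For (b), \<open>H\<close> acts on itself with a left-invariant metric in which \<open>k\<close> has superlinear weight in its
  length in \<open>G\<close>. Orbits of any \<open>G\<close>-action grow at most linearly, so an extension forces every
  element of \<open>H\<close> to be an efficient product of short elements of \<open>H\<close>.

  For (a), the nearest-point projection \<open>G \<rightarrow> H\<close> followed by an orbit map is used to pull the distance
  functions of \<open>R\<close> back to \<open>G \<times> R\<close>; the supremum of the differences of their \<open>G\<close>-translates is an
  invariant pseudometric. It is finite provided that on every coset \<open>g H\<close> the projection is coarsely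
  Lipschitz for the metric of the orbit in \<open>R\<close>. By hyperbolicity, the projection of \<open>g H\<close> is
  either uniformly bounded or \<open>g \<in> H v H\<close> for one of finitely many \<open>v\<close> with \<open>H \<inter> v H v\<^sup>-\<^sup>1\<close> infinite. In the
  almost malnormal case the latter means \<open>g \<in> H\<close>. In the virtually cyclic case conjugation by \<open>v\<close> maps
  some power of a generator \<open>a\<close> to itself or to its inverse, which does not change the
  distances within the orbit of \<open>\<langle>a\<rangle>\<close>.
\<close>

section \<open>Words and word metrics\<close>

abbreviation word_value :: "('g, 'm) monoid_scheme \<Rightarrow> 'g list \<Rightarrow> 'g" where
  "word_value G ws \<equiv> foldr (\<lambda>a b. a \<otimes>\<^bsub>G\<^esub> b) ws \<one>\<^bsub>G\<^esub>"

context group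
begin

lemma inv_cancel_left:
  assumes "a \<in> carrier G" "b \<in> carrier G"
  shows "inv a \<otimes> (a \<otimes> b) = b" "a \<otimes> (inv a \<otimes> b) = b"
  using assms by (simp_all add: m_assoc[symmetric])

lemmas group_normalize = m_assoc inv_mult_group inv_cancel_left

lemma word_value_closed: "set ws \<subseteq> carrier G \<Longrightarrow> word_value G ws \<in> carrier G"
  by (induction ws) auto

lemma word_value_append:
  "set us \<subseteq> carrier G \<Longrightarrow> set vs \<subseteq> carrier G \<Longrightarrow>
   word_value G (us @ vs) = word_value G us \<otimes> word_value G vs"
  by (induction us) (auto simp: word_value_closed m_assoc)

lemma word_value_rev_inv:
  "set ws \<subseteq> carrier G \<Longrightarrow> word_value G (rev (map (m_inv G) ws)) = inv (word_value G ws)"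
proof (induction ws)
  case (Cons w ws)
  have "set (rev (map (m_inv G) ws)) \<subseteq> carrier G" using Cons.prems by auto
  with Cons show ?case
    by (simp add: word_value_append inv_mult_group word_value_closed del: foldr_append)
qed simp

lemma word_value_in_subgroup:
  assumes "subgroup H G" "set ws \<subseteq> H"
  shows "word_value G ws \<in> H"
  using assms(2)
  by (induction ws) (auto simp: assms(1) subgroup.m_closed subgroup.one_closed)

lemma word_value_concat:
  "(\<And>k. k \<in> set ks \<Longrightarrow> set (F k) \<subseteq> carrier G \<and> word_value G (F k) = k) \<Longrightarrow>
   word_value G (concat (map F ks)) = word_value G ks"
proof (induction ks)
  case (Cons k ks)
  have "set (concat (map F ks)) \<subseteq> carrier G" using Cons.prems by auto
  with Cons show ?case by (simp add: word_value_append del: foldr_append)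
qed simp

text \<open>Converts a path of points into a factorization of the quotient of its endpoints; when
  the points lie in a subgroup, so do the factors.\<close>

lemma word_value_telescope:
  assumes "\<And>i. i \<le> n \<Longrightarrow> x i \<in> carrier G"
  shows "word_value G (map (\<lambda>i. inv (x i) \<otimes> x (Suc i)) [0..<n]) = inv (x 0) \<otimes> x n"
  using assms
proof (induction n)
  case (Suc n)
  have "set (map (\<lambda>i. inv (x i) \<otimes> x (Suc i)) [0..<n]) \<subseteq> carrier G"
    using Suc.prems by auto
  then show ?case
    using Suc by (simp add: word_value_append group_normalize del: foldr_append)
qed simp

end

locale generated_group = group G for G (structure) +
  fixes X
  assumes generating: "finite_generating_set G X"
begin

abbreviation len where "len \<equiv> word_length G X"
abbreviation d where "d \<equiv> word_dist G X"
abbreviation letters where "letters \<equiv> X \<union> (\<lambda>x. inv x) ` X"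

lemma letters_subset: "letters \<subseteq> carrier G"
  and finite_letters: "finite letters"
  using generating by (auto simp: finite_generating_set_def)

lemma letters_inv: "x \<in> letters \<Longrightarrow> inv x \<in> letters"
  using generating by (force simp: finite_generating_set_def)

lemma len_le:
  assumes "set ws \<subseteq> letters"
  shows "len (word_value G ws) \<le> length ws"
  unfolding word_length_def by (rule Least_le) (use assms in blast)

lemma ex_letter_word:
  assumes "g \<in> carrier G"
  shows "\<exists>ws. set ws \<subseteq> letters \<and> word_value G ws = g"
proof -
  have "g \<in> generate G X"
    using assms generating by (simp add: finite_generating_set_def)
  then show ?thesis
  proof induction
    case one
    show ?case by (rule exI[of _ "[]"]) simp
  next
    case (incl h)
    then show ?case
      using letters_subset by (intro exI[of _ "[h]"]) auto
  next
    case (inv h)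
    then show ?case
      using letters_subset by (intro exI[of _ "[inv h]"]) auto
  next
    case (eng h1 h2)
    then obtain us vs where "set us \<subseteq> letters" "word_value G us = h1"
      "set vs \<subseteq> letters" "word_value G vs = h2" by blast
    then show ?case
      using word_value_append[OF subset_trans[OF _ letters_subset] subset_trans[OF _ letters_subset]]
      by (intro exI[of _ "us @ vs"]) (simp del: foldr_append)
  qed
qed

lemma ex_shortest_word:
  assumes "g \<in> carrier G"
  obtains ws where "set ws \<subseteq> letters" "word_value G ws = g" "length ws = len g"
proof -
  have "\<exists>n ws. length ws = n \<and> set ws \<subseteq> letters \<and> word_value G ws = g"
    using ex_letter_word[OF assms] by blast
  from LeastI_ex[OF this] show ?thesis
    using that unfolding word_length_def by blast
qed

lemma len_one [simp]: "len \<one> = 0"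
  using len_le[of "[]"] by simp

lemma len_eq_0: "g \<in> carrier G \<Longrightarrow> len g = 0 \<longleftrightarrow> g = \<one>"
  by (metis ex_shortest_word foldr_Nil id_apply length_0_conv len_one)

lemma len_mult:
  assumes "g \<in> carrier G" "h \<in> carrier G"
  shows "len (g \<otimes> h) \<le> len g + len h"
proof -
  obtain us vs where "set us \<subseteq> letters" "word_value G us = g" "length us = len g"
    "set vs \<subseteq> letters" "word_value G vs = h" "length vs = len h"
    using assms by (metis ex_shortest_word)
  then show ?thesis
    using len_le[of "us @ vs"] letters_subset word_value_append[of us vs]
    by (simp del: foldr_append)
qed

lemma len_inv_le:
  assumes "g \<in> carrier G"
  shows "len (inv g) \<le> len g"
proof -
  obtain us where us: "set us \<subseteq> letters" "word_value G us = g" "length us = len g"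
    using assms by (metis ex_shortest_word)
  have "set (rev (map (m_inv G) us)) \<subseteq> letters"
    unfolding set_rev set_map using us(1) letters_inv by blast
  from len_le[OF this] word_value_rev_inv[OF subset_trans[OF us(1) letters_subset]] show ?thesis
    by (simp only: us length_rev length_map)
qed

lemma len_inv [simp]: "g \<in> carrier G \<Longrightarrow> len (inv g) = len g"
  using len_inv_le[of g] len_inv_le[of "inv g"] by simp

text \<open>This finiteness makes constants uniform later: maxima are taken over balls, and the
  pigeonhole principle is applied to them.\<close>

lemma finite_ball: "finite {g \<in> carrier G. len g \<le> n}"
proof (rule finite_subset)
  show "finite (word_value G ` {ws. set ws \<subseteq> letters \<and> length ws \<le> n})"
    by (intro finite_imageI finite_lists_length_le finite_letters)
  show "{g \<in> carrier G. len g \<le> n} \<subseteq> word_value G ` {ws. set ws \<subseteq> letters \<and> length ws \<le> n}"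
    by (smt (verit) ex_shortest_word image_eqI mem_Collect_eq subsetI)
qed

lemma d_nonneg [simp]: "d x y \<ge> 0"
  by (simp add: word_dist_def)

lemma d_self [simp]: "x \<in> carrier G \<Longrightarrow> d x x = 0"
  by (simp add: word_dist_def)

lemma d_eq_0: "x \<in> carrier G \<Longrightarrow> y \<in> carrier G \<Longrightarrow> d x y = 0 \<longleftrightarrow> x = y"
  using len_eq_0[of "inv x \<otimes> y"] inv_cancel_left(2)[of x y]
  by (metis d_self inv_closed m_closed of_nat_eq_0_iff r_one word_dist_def)

lemma d_commute: "x \<in> carrier G \<Longrightarrow> y \<in> carrier G \<Longrightarrow> d x y = d y x"
  using len_inv[of "inv x \<otimes> y"] by (simp add: word_dist_def group_normalize)

lemma d_triangle:
  assumes "x \<in> carrier G" "y \<in> carrier G" "z \<in> carrier G"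
  shows "d x z \<le> d x y + d y z"
proof -
  have "inv x \<otimes> z = (inv x \<otimes> y) \<otimes> (inv y \<otimes> z)"
    using assms by (simp add: group_normalize)
  then have "len (inv x \<otimes> z) \<le> len (inv x \<otimes> y) + len (inv y \<otimes> z)"
    using assms by (simp only: len_mult m_closed inv_closed)
  then show ?thesis
    by (simp add: word_dist_def)
qed

lemma d_translate:
  "g \<in> carrier G \<Longrightarrow> x \<in> carrier G \<Longrightarrow> y \<in> carrier G \<Longrightarrow> d (g \<otimes> x) (g \<otimes> y) = d x y"
  by (simp add: word_dist_def group_normalize)

lemma d_mult_right: "x \<in> carrier G \<Longrightarrow> g \<in> carrier G \<Longrightarrow> d x (x \<otimes> g) = len g"
  by (simp add: word_dist_def group_normalize)

text \<open>The prefixes of a shortest word trace a geodesic, because every subword of a shortest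
  word is again shortest.\<close>

lemma geodesic_exists:
  assumes x: "x \<in> carrier G" and y: "y \<in> carrier G"
  obtains p where "cayley_geodesic G X (len (inv x \<otimes> y)) p" "p 0 = x" "p (len (inv x \<otimes> y)) = y"
proof -
  obtain ws where ws: "set ws \<subseteq> letters" "word_value G ws = inv x \<otimes> y"
    "length ws = len (inv x \<otimes> y)"
    using x y by (metis ex_shortest_word inv_closed m_closed)
  let ?n = "length ws"
  define p where "p i = x \<otimes> word_value G (take i ws)" for i
  have sub: "set us \<subseteq> carrier G" if "set us \<subseteq> set ws" for us
    using that ws(1) letters_subset by auto
  have cl: "word_value G us \<in> carrier G" if "set us \<subseteq> set ws" for us
    using word_value_closed sub that by simp
  note st = set_take_subset set_drop_subset subset_trans[OF set_take_subset set_drop_subset]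
  have p: "p i \<in> carrier G" for i
    unfolding p_def using cl[OF set_take_subset] x by simp
  have dist: "d (p i) (p j) = real j - real i" if ij: "i \<le> j" "j \<le> ?n" for i j
  proof -
    let ?u = "take i ws" and ?v = "take (j - i) (drop i ws)" and ?w = "drop j ws"
    have j: "take j ws = ?u @ ?v"
      using ij by (metis le_add_diff_inverse take_add)
    have "p j = p i \<otimes> word_value G ?v"
      using x cl[OF st(1)] cl[OF st(3)] word_value_append[OF sub[OF st(1)] sub[OF st(3)]]
      by (simp add: p_def j m_assoc del: foldr_append)
    then have d: "d (p i) (p j) = len (word_value G ?v)"
      using d_mult_right p cl[OF st(3)] by simp
    have "word_value G ws = word_value G ?u \<otimes> (word_value G ?v \<otimes> word_value G ?w)"
      using word_value_append[OF sub[OF st(1)] sub[OF st(3)], of i "j - i" i]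
        cl[OF st(1), of i] cl[OF st(3), of "j - i" i] cl[OF st(2), of j]
        word_value_append[OF sub[OF st(1)] sub[OF st(2)], of j j]
      by (simp only: j[symmetric] append_take_drop_id m_assoc)
    \<comment> \<open>The three pieces have total length \<open>len (word_value G ws)\<close>, so
      the bound \<open>len_le\<close> must be an equality for each of them.\<close>
    then have "len (word_value G ws) \<le>
        len (word_value G ?u) + (len (word_value G ?v) + len (word_value G ?w))"
      using cl[OF st(1), of i] cl[OF st(3), of "j - i" i] cl[OF st(2), of j]
        len_mult[of "word_value G ?u" "word_value G ?v \<otimes> word_value G ?w"]
        len_mult[of "word_value G ?v" "word_value G ?w"] by simp
    moreover have "len (word_value G us) \<le> length us" if "set us \<subseteq> set ws" for us
      using len_le that ws(1) by blast
    note this[OF st(1), of i] this[OF st(3), of "j - i" i] this[OF st(2), of j]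
    ultimately have "len (word_value G ?v) = j - i"
      using ij ws(2,3) by simp
    then show ?thesis using d ij by simp
  qed
  have "cayley_geodesic G X ?n p"
    unfolding cayley_geodesic_def
  proof (intro conjI allI impI p)
    fix i j assume "i \<le> ?n" "j \<le> ?n"
    then show "d (p i) (p j) = \<bar>real i - real j\<bar>"
      using dist[of i j] dist[of j i] d_commute[OF p[of i] p[of j]] by (cases "i \<le> j") auto
  qed
  moreover have "p 0 = x" "p ?n = y"
    using x y by (simp_all add: p_def ws(2) group_normalize)
  ultimately show ?thesis
    using that ws(3) by simp
qed

text \<open>The constant is the largest \<open>X\<close>-length of a letter of \<open>X'\<close>;
  substituting letter by letter gives the estimate.\<close>

lemma change_of_generators:
  assumes "finite_generating_set G X'"
  shows "\<exists>c. \<forall>g\<in>carrier G. len g \<le> c * word_length G X' g"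
proof -
  interpret Y: generated_group G X'
    using assms by unfold_locales
  define c where "c = Max (insert 0 (len ` Y.letters))"
  have c: "len y \<le> c" if "y \<in> Y.letters" for y
    unfolding c_def using that Y.finite_letters by (intro Max_ge) auto
  have *: "len (word_value G ws) \<le> c * length ws" if "set ws \<subseteq> Y.letters" for ws
    using that
  proof (induction ws)
    case (Cons w ws)
    then have "w \<in> carrier G" "word_value G ws \<in> carrier G"
      using Y.letters_subset word_value_closed[of ws] by auto
    then have "len (w \<otimes> word_value G ws) \<le> len w + len (word_value G ws)"
      by (rule len_mult)
    with Cons c[of w] show ?case by simp
  qed simp
  show ?thesis
    by (metis "*" Y.ex_shortest_word)
qed

end

section \<open>Undistorted and quasiconvex subgroups\<close>

context generated_group
begin

text \<open>Equivalent to \<open>H\<close> being finitely generated and quasi-isometrically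
  embedded. Factorizations avoid choosing a generating set of \<open>H\<close>: the finite ball of
  radius \<open>R\<close> in \<open>H\<close> serves as one.\<close>

definition undistorted :: "'a set \<Rightarrow> bool" where
  "undistorted H \<longleftrightarrow> (\<exists>R L. \<forall>h\<in>H. \<exists>hs. set hs \<subseteq> H \<and> (\<forall>k\<in>set hs. len k \<le> R) \<and>
      length hs \<le> L * len h \<and> word_value G hs = h)"

text \<open>The inner condition of \<open>quasiconvex_subgroup\<close>, with the generating set
  \<open>X\<close> and the constant fixed.\<close>

definition geodesically_quasiconvex :: "'a set \<Rightarrow> real \<Rightarrow> bool" where
  "geodesically_quasiconvex H K \<longleftrightarrow>
     (\<forall>n p. cayley_geodesic G X n p \<and> p 0 \<in> H \<and> p n \<in> H \<longrightarrow>
        (\<forall>i\<le>n. \<exists>h\<in>H. d (p i) h \<le> K))"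

text \<open>Word lengths are natural numbers, so the minimum is attained; ties are broken by choice,
  and therefore the map is equivariant only up to bounded error.\<close>

definition nearest_point :: "'a set \<Rightarrow> 'a \<Rightarrow> 'a" where
  "nearest_point H g = arg_min (\<lambda>h. len (inv g \<otimes> h)) (\<lambda>h. h \<in> H)"

lemma nearest_point_in: "subgroup H G \<Longrightarrow> nearest_point H g \<in> H"
  unfolding nearest_point_def by (rule arg_min_natI) (rule subgroup.one_closed)

lemma nearest_point_le: "h \<in> H \<Longrightarrow> d g (nearest_point H g) \<le> d g h"
  unfolding nearest_point_def word_dist_def
  using arg_min_nat_le[of "\<lambda>h. h \<in> H" h "\<lambda>h. len (inv g \<otimes> h)"] by simp

lemma nearest_point_id:
  assumes "subgroup H G" "h \<in> H"
  shows "nearest_point H h = h"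
proof -
  have "h \<in> carrier G" "nearest_point H h \<in> carrier G"
    using assms nearest_point_in[OF assms(1)] by (auto dest: subgroup.mem_carrier)
  moreover have "d h (nearest_point H h) = 0"
    using nearest_point_le[OF assms(2), of h] calculation d_nonneg[of h "nearest_point H h"] by simp
  ultimately show ?thesis
    using d_eq_0 by metis
qed

text \<open>The two word metrics are bi-Lipschitz equivalent: one comparison constant rescales the
  radius, the other the number of factors.\<close>

lemma undistorted_change_of_generators:
  assumes X': "finite_generating_set G X'" and H: "H \<subseteq> carrier G"
    and und: "generated_group.undistorted G X' H"
  shows "undistorted H"
proof -
  interpret Y: generated_group G X'
    using X' by unfold_locales
  obtain R L where RL: "\<And>h. h \<in> H \<Longrightarrow> \<exists>hs. set hs \<subseteq> H \<and> (\<forall>k\<in>set hs. Y.len k \<le> R) \<and>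
      length hs \<le> L * Y.len h \<and> word_value G hs = h"
    using und unfolding Y.undistorted_def by blast
  obtain c where c: "\<And>g. g \<in> carrier G \<Longrightarrow> len g \<le> c * Y.len g"
    using change_of_generators[OF X'] by blast
  obtain c' where c': "\<And>g. g \<in> carrier G \<Longrightarrow> Y.len g \<le> c' * len g"
    using Y.change_of_generators[OF generating] by blast
  have "\<exists>hs. set hs \<subseteq> H \<and> (\<forall>k\<in>set hs. len k \<le> c * R) \<and>
      length hs \<le> (L * c') * len h \<and> word_value G hs = h" if h: "h \<in> H" for h
  proof -
    obtain hs where hs: "set hs \<subseteq> H" "\<And>k. k \<in> set hs \<Longrightarrow> Y.len k \<le> R"
      "length hs \<le> L * Y.len h" "word_value G hs = h"
      using RL[OF h] by blast
    have "len k \<le> c * R" if "k \<in> set hs" for k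
    proof -
      have "len k \<le> c * Y.len k"
        using hs(1) H that by (intro c) auto
      also have "\<dots> \<le> c * R"
        using hs(2)[OF that] by (rule mult_le_mono2)
      finally show ?thesis .
    qed
    moreover have "length hs \<le> (L * c') * len h"
      using le_trans[OF hs(3) mult_le_mono2[OF c'[OF subsetD[OF H h]]]] by (simp add: mult.assoc)
    ultimately show ?thesis
      using hs by blast
  qed
  then show ?thesis
    unfolding undistorted_def by blast
qed

text \<open>Each vertex of a geodesic from \<open>\<one>\<close> to \<open>h\<close> is moved to a
  nearest point of \<open>H\<close>. Consecutive nearest points are at distance at most
  \<open>2 * K + 1\<close>, and their quotients form a word with \<open>len h\<close>
  factors.\<close>

lemma geodesically_quasiconvex_imp_undistorted:
  assumes H: "subgroup H G" and qc: "geodesically_quasiconvex H K"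
  shows "undistorted H"
proof -
  have "\<exists>hs. set hs \<subseteq> H \<and> (\<forall>k\<in>set hs. len k \<le> nat \<lceil>2 * K + 1\<rceil>) \<and>
      length hs \<le> 1 * len h \<and> word_value G hs = h" if h: "h \<in> H" for h
  proof -
    note Hc = subgroup.mem_carrier[OF H]
    define n where "n = len h"
    obtain p where p: "cayley_geodesic G X n p" "p 0 = \<one>" "p n = h"
      using geodesic_exists[of \<one> h] Hc[OF h] by (auto simp: n_def)
    have pc: "p i \<in> carrier G" and pd: "d (p i) (p j) = \<bar>real i - real j\<bar>" if "i \<le> n" "j \<le> n" for i j
      using p(1) that by (auto simp: cayley_geodesic_def)
    define x where "x i = nearest_point H (p i)" for i
    have xH: "x i \<in> H" for i
      unfolding x_def by (rule nearest_point_in[OF H])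
    have xp: "d (p i) (x i) \<le> K" if "i \<le> n" for i
    proof -
      have "cayley_geodesic G X n p \<and> p 0 \<in> H \<and> p n \<in> H"
        using p h subgroup.one_closed[OF H] by simp
      from qc[unfolded geodesically_quasiconvex_def, rule_format, OF this that]
      obtain k where "k \<in> H" "d (p i) k \<le> K" ..
      then show ?thesis
        unfolding x_def using nearest_point_le[of k H "p i"] by simp
    qed
    let ?hs = "map (\<lambda>i. inv (x i) \<otimes> x (Suc i)) [0..<n]"
    have "set ?hs \<subseteq> H"
      using xH H by (auto intro: subgroup.m_closed subgroup.m_inv_closed)
    moreover have "len k \<le> nat \<lceil>2 * K + 1\<rceil>" if k: "k \<in> set ?hs" for k
    proof -
      obtain i where i: "i < n" "k = inv (x i) \<otimes> x (Suc i)"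
        using k by auto
      have "real (len k) = d (x i) (x (Suc i))"
        by (simp add: i word_dist_def)
      also have "\<dots> \<le> d (x i) (p i) + (d (p i) (p (Suc i)) + d (p (Suc i)) (x (Suc i)))"
        using d_triangle[of "x i" "p i" "x (Suc i)"] d_triangle[of "p i" "p (Suc i)" "x (Suc i)"]
          pc[of i i] pc[of "Suc i" i] i(1) Hc[OF xH] by fastforce
      also have "\<dots> \<le> 2 * K + 1"
        using xp[of i] xp[of "Suc i"] pd[of i "Suc i"] i(1) d_commute[of "x i" "p i"] pc[of i i]
          Hc[OF xH] by simp
      finally show ?thesis
        by linarith
    qed
    moreover have "x 0 = \<one>" "x n = h"
      using p h nearest_point_id[OF H] subgroup.one_closed[OF H] by (simp_all add: x_def)
    then have "word_value G ?hs = h"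
      using word_value_telescope[of n x] Hc[OF xH] Hc[OF h] by simp
    ultimately show ?thesis
      by (intro exI[of _ ?hs]) (simp add: n_def)
  qed
  then show ?thesis
    unfolding undistorted_def by blast
qed

end

section \<open>Quasiconvexity of undistorted subgroups of hyperbolic groups\<close>

locale hyperbolic_generated_group = generated_group +
  fixes \<delta> :: real
  assumes delta_nonneg: "\<delta> \<ge> 0"
    and four_point: "\<And>w x y z. w \<in> carrier G \<Longrightarrow> x \<in> carrier G \<Longrightarrow> y \<in> carrier G \<Longrightarrow> z \<in> carrier G \<Longrightarrow>
      gromov_product d w x z \<ge> min (gromov_product d w x y) (gromov_product d w y z) - \<delta>"
begin

abbreviation gp where "gp \<equiv> gromov_product d"

text \<open>Repeatedly halving the chain costs one \<open>\<delta>\<close> per halving, hence the logarithmic loss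
  that makes detours away from a geodesic exponentially long.\<close>

lemma gromov_product_chain:
  assumes "w \<in> carrier G" "R \<ge> 0"
    and "\<And>i. i \<le> n \<Longrightarrow> x i \<in> carrier G" "\<And>i. i \<le> n \<Longrightarrow> d (x i) w \<ge> A"
    and "\<And>i. i < n \<Longrightarrow> d (x i) (x (Suc i)) \<le> R" and "n \<le> 2 ^ k"
  shows "gp w (x 0) (x n) \<ge> A - R - real k * \<delta>"
  using assms(3-)
proof (induction k arbitrary: n x)
  case 0
  then consider "n = 0" | "n = 1" by fastforce
  then show ?case
  proof cases
    case 1
    then show ?thesis using "0.prems"(1,2)[of 0] assms(2) by (simp add: gromov_product_def)
  next
    case 2
    then show ?thesis
      using "0.prems"(1,2)[of 0] "0.prems"(1,2)[of 1] "0.prems"(3)[of 0] assms(1,2)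
      by (simp add: gromov_product_def)
  qed
next
  case (Suc k)
  show ?case
  proof (cases "n \<le> 2 ^ k")
    case True
    then show ?thesis
      using Suc.IH[of n x] Suc.prems delta_nonneg by (simp add: algebra_simps)
  next
    case False
    define m :: nat where "m = 2 ^ k"
    have m: "m < n" "n - m \<le> m"
      using False Suc.prems(4) by (auto simp: m_def)
    have "gp w (x 0) (x m) \<ge> A - R - real k * \<delta>"
      using m Suc.prems by (intro Suc.IH) (auto simp: m_def)
    moreover have "gp w (x (m + 0)) (x (m + (n - m))) \<ge> A - R - real k * \<delta>"
      using m Suc.prems by (intro Suc.IH[of "n - m" "\<lambda>i. x (m + i)"]) (auto simp: m_def)
    moreover have "gp w (x 0) (x n) \<ge> min (gp w (x 0) (x m)) (gp w (x m) (x n)) - \<delta>"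
      using m Suc.prems(1) assms(1) by (intro four_point) auto
    ultimately show ?thesis
      using m by (simp add: algebra_simps min_def split: if_splits)
  qed
qed

end

text \<open>The least \<open>k\<close> with \<open>2 ^ k\<close> above a fixed multiple of
  \<open>D\<close> is logarithmic in \<open>D\<close>, so \<open>k * \<delta>\<close> is eventually
  smaller than \<open>D\<close>.\<close>

lemma linear_beats_log:
  fixes R \<delta> :: real and L :: nat
  shows "\<exists>D0::nat. \<forall>D::nat. D \<ge> D0 \<longrightarrow> (\<exists>k::nat. L * D \<le> 2 ^ k \<and> R + (real k + 2) * \<delta> < D)"
proof -
  have "(\<lambda>k::nat. (R + (real k + 2) * \<delta>) / 2 ^ k) \<longlonglongrightarrow> 0"
    by real_asymp
  then have "\<forall>\<^sub>F k::nat in sequentially. (R + (real k + 2) * \<delta>) / 2 ^ k < 1 / (2 * (real L + 2))"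
    by (rule order_tendstoD) simp
  then obtain k0 :: nat where "\<forall>k\<ge>k0. (R + (real k + 2) * \<delta>) / 2 ^ k < 1 / (2 * (real L + 2))"
    unfolding eventually_sequentially ..
  then have k0: "(R + (real k + 2) * \<delta>) / 2 ^ k < 1 / (2 * (real L + 2))" if "k \<ge> k0" for k :: nat
    using that by simp
  show ?thesis
  proof (rule exI[of _ "2 ^ k0"], intro allI impI)
    fix D :: nat assume D: "2 ^ k0 \<le> D"
    then have D1: "D \<ge> 1" by (metis le_trans one_le_numeral one_le_power)
    \<comment> \<open>The factor \<open>L + 2\<close> instead of \<open>L\<close> forces
      \<open>2 ^ k \<ge> D\<close> and \<open>k > 0\<close> even if \<open>L = 0\<close>; minimality
      of \<open>k\<close> then bounds \<open>2 ^ k\<close> from above.\<close>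
    define k where "k = (LEAST k. (L + 2) * D \<le> 2 ^ k)"
    have "(L + 2) * D \<le> 2 ^ ((L + 2) * D)"
      by (rule less_imp_le[OF less_exp])
    then have k: "(L + 2) * D \<le> 2 ^ k"
      unfolding k_def by (rule LeastI)
    have "D \<le> (L + 2) * D" by simp
    then have "(2::nat) ^ k0 \<le> 2 ^ k" using k D by linarith
    then have "k0 \<le> k" by simp
    then have "(R + (real k + 2) * \<delta>) / 2 ^ k < 1 / (2 * (real L + 2))" by (rule k0)
    then have *: "R + (real k + 2) * \<delta> < 2 ^ k / (2 * (real L + 2))"
      by (simp add: field_simps)
    have "k \<noteq> 0" using k D1 by (intro notI) simp
    then obtain j where j: "k = Suc j" by (cases k) auto
    have "\<not> (L + 2) * D \<le> 2 ^ j"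
      using not_less_Least[of j "\<lambda>k. (L + 2) * D \<le> 2 ^ k"] j by (simp add: k_def)
    then have "2 ^ k < 2 * ((L + 2) * D)" by (simp add: j)
    then have "real (2 ^ k) < real (2 * ((L + 2) * D))" by (simp only: of_nat_less_iff)
    then have "2 ^ k / (2 * (real L + 2)) < D"
      by (simp add: field_simps)
    with * have "R + (real k + 2) * \<delta> < D" by simp
    moreover have "L * D \<le> 2 ^ k" using k by simp
    ultimately show "\<exists>k::nat. L * D \<le> 2 ^ k \<and> R + (real k + 2) * \<delta> < D" by blast
  qed
qed

context hyperbolic_generated_group
begin

text \<open>Let \<open>p j\<close> be the vertex farthest from \<open>H\<close>, at distance
  \<open>D\<close>. A detour leaves the geodesic near \<open>p j\<close>, runs through
  \<open>H\<close> in \<open>O(D)\<close> steps of bounded length and returns, never coming closer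
  to \<open>p j\<close> than \<open>D\<close>. By \<open>gromov_product_chain\<close> the two ends
  then have product at least \<open>D - O(log D)\<close> at \<open>p j\<close>, whereas on a
  geodesic this product is \<open>0\<close>; so \<open>D\<close> is bounded.\<close>

lemma undistorted_imp_geodesically_quasiconvex:
  assumes H: "subgroup H G" and und: "undistorted H"
  shows "\<exists>K. geodesically_quasiconvex H K"
proof -
  note Hc = subgroup.mem_carrier[OF H]
  obtain R L where RL: "\<And>h. h \<in> H \<Longrightarrow> \<exists>hs. set hs \<subseteq> H \<and> (\<forall>k\<in>set hs. len k \<le> R) \<and>
      length hs \<le> L * len h \<and> word_value G hs = h"
    using und unfolding undistorted_def by blast
  \<comment> \<open>The factor 6 comes from the distance between the ends of the detour in
    \<open>H\<close>, which is at most \<open>D + 4 * D + D\<close>.\<close>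
  obtain D0 :: nat where D0: "\<And>D::nat. D \<ge> D0 \<Longrightarrow> \<exists>k::nat. (6 * L) * D \<le> 2 ^ k \<and> real R + (real k + 2) * \<delta> < D"
    using linear_beats_log[of "6 * L" "real R" \<delta>] by blast
  have "\<exists>h\<in>H. d (p i) h \<le> D0"
    if p: "cayley_geodesic G X n p" "p 0 \<in> H" "p n \<in> H" and i: "i \<le> n" for n p i
  proof -
    have pc: "p i \<in> carrier G" and pd: "d (p i) (p j) = \<bar>real i - real j\<bar>" if "i \<le> n" "j \<le> n" for i j
      using p(1) that by (auto simp: cayley_geodesic_def)
    let ?x = "\<lambda>i. nearest_point H (p i)"
    have xH: "?x i \<in> H" and xc: "?x i \<in> carrier G" for i
      using nearest_point_in[OF H] Hc by auto
    define f where "f i = len (inv (p i) \<otimes> ?x i)" for i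
    have f: "d (p i) (?x i) = f i" for i
      by (simp add: f_def word_dist_def)
    define D where "D = Max (f ` {..n})"
    have "D \<in> f ` {..n}" unfolding D_def by (rule Max_in) auto
    then obtain j where j: "j \<le> n" "f j = D" by auto
    have fD: "f i \<le> D" if "i \<le> n" for i
      unfolding D_def using that by (intro Max_ge) auto
    have far: "d h (p j) \<ge> D" if "h \<in> H" for h
      using nearest_point_le[OF that, of "p j"] f[of j] j d_commute[of h "p j"] Hc[OF that] pc by simp
    \<comment> \<open>Truncated subtraction and \<open>min\<close> stop at the ends of the geodesic,
      which lie in \<open>H\<close>; otherwise the cut is exactly \<open>2 * D\<close> away from
      \<open>p j\<close>.\<close>
    define a where "a = j - 2 * D"
    define b where "b = min n (j + 2 * D)"
    have ab: "a \<le> n" "b \<le> n" "a \<le> j" "j \<le> b" "b - a \<le> 4 * D"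
      using j by (auto simp: a_def b_def)
    \<comment> \<open>At a cut the distances give \<open>(2 * D + D - D) / 2\<close>; at an endpoint
      in \<open>H\<close> the nearest point is the endpoint itself, and the product is its distance
      to \<open>p j\<close>.\<close>
    have end_gp: "gp (p j) (p c) (?x c) \<ge> D"
      if c: "c \<le> n" "\<bar>real c - real j\<bar> = 2 * D \<or> p c \<in> H" for c
    proof (cases "p c \<in> H")
      case True
      then show ?thesis
        using far[of "p c"] nearest_point_id[OF H, of "p c"] pc[OF c(1) c(1)]
        by (simp add: gromov_product_def)
    next
      case False
      then have "d (p c) (p j) = 2 * D" using c pd j by auto
      moreover have "d (?x c) (p j) \<ge> D" by (rule far[OF xH])
      moreover have "d (p c) (?x c) \<le> D" using fD[OF c(1)] f by simp
      ultimately show ?thesis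
        by (simp add: gromov_product_def)
    qed
    have "\<bar>real a - real j\<bar> = 2 * D \<or> p a \<in> H"
      using p(2) by (cases "2 * D \<le> j") (auto simp: a_def of_nat_diff)
    then have ga: "gp (p j) (p a) (?x a) \<ge> D" using end_gp ab by blast
    have "\<bar>real b - real j\<bar> = 2 * D \<or> p b \<in> H"
      using p(3) by (cases "j + 2 * D \<le> n") (auto simp: b_def)
    then have gb: "gp (p j) (p b) (?x b) \<ge> D" using end_gp ab by blast
    have g0: "gp (p j) (p a) (p b) = 0"
      using pd ab j by (simp add: gromov_product_def)
    have g1: "0 \<ge> min (gp (p j) (p a) (?x a)) (gp (p j) (?x a) (p b)) - \<delta>"
      using four_point[of "p j" "p a" "?x a" "p b"] g0 pc ab j xc by simp
    have g2: "gp (p j) (?x a) (p b) \<ge> min (gp (p j) (?x a) (?x b)) (gp (p j) (?x b) (p b)) - \<delta>"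
      using four_point[of "p j" "?x a" "?x b" "p b"] pc ab j xc by simp
    have gb': "gp (p j) (?x b) (p b) \<ge> D"
      using gb d_commute[of "p b" "?x b"] pc[of b b] ab xc by (simp add: gromov_product_def)
    define h where "h = inv (?x a) \<otimes> ?x b"
    have h: "h \<in> H"
      using xH H by (simp add: h_def subgroup.m_closed subgroup.m_inv_closed)
    then obtain hs where hs: "set hs \<subseteq> H" "\<And>k. k \<in> set hs \<Longrightarrow> len k \<le> R"
      "length hs \<le> L * len h" "word_value G hs = h"
      using RL by blast
    define x where "x i = ?x a \<otimes> word_value G (take i hs)" for i
    have tk: "word_value G (take i hs) \<in> H" for i
      using word_value_in_subgroup[OF H] hs(1) set_take_subset[of i hs] by blast
    have xxH: "x i \<in> H" for i
      unfolding x_def by (rule subgroup.m_closed[OF H xH tk])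
    have "real (len h) = d (?x a) (?x b)"
      by (simp add: h_def word_dist_def)
    also have "\<dots> \<le> d (?x a) (p a) + (d (p a) (p b) + d (p b) (?x b))"
      using d_triangle[of "?x a" "p a" "?x b"] d_triangle[of "p a" "p b" "?x b"] xc pc ab by fastforce
    also have "\<dots> \<le> real D + (4 * real D + real D)"
      using f[of a] f[of b] fD[of a] fD[of b] ab pd[of a b] d_commute[of "p a" "?x a"] xc pc[of a a]
      by (intro add_mono) (auto simp: of_nat_diff)
    finally have "len h \<le> 6 * D" by simp
    from le_trans[OF hs(3) mult_le_mono2[OF this]] have lenhs: "length hs \<le> (6 * L) * D"
      by (simp add: mult.assoc mult.left_commute)
    show ?thesis
    proof (rule ccontr)
      assume *: "\<not> ?thesis"
      have "D \<ge> D0"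
        using * xH[of i] f[of i] fD[OF i] by (force simp: not_le)
      then obtain k :: nat where k: "(6 * L) * D \<le> 2 ^ k" "R + (real k + 2) * \<delta> < D"
        using D0 by blast
      have "gp (p j) (x 0) (x (length hs)) \<ge> D - real R - real k * \<delta>"
      proof (rule gromov_product_chain)
        show "p j \<in> carrier G" using pc j by blast
        show "length hs \<le> 2 ^ k" using lenhs k by linarith
        fix i
        show "x i \<in> carrier G" by (rule Hc[OF xxH])
        show "D \<le> d (x i) (p j)" by (rule far[OF xxH])
        assume i: "i < length hs"
        then have k: "hs ! i \<in> H" "len (hs ! i) \<le> R"
          using hs by auto
        have s: "set (take i hs) \<subseteq> carrier G" "set [hs ! i] \<subseteq> carrier G"
          using hs(1) set_take_subset[of i hs] Hc k(1) by auto
        have "x (Suc i) = x i \<otimes> hs ! i"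
          using Hc[OF k(1)] Hc[OF tk] xc word_value_append[OF s] i
          by (simp add: x_def take_Suc_conv_app_nth m_assoc del: foldr_append)
        then show "d (x i) (x (Suc i)) \<le> R"
          using d_mult_right[OF Hc[OF xxH] Hc[OF k(1)]] k(2) by simp
      qed simp
      moreover have "x 0 = ?x a" "x (length hs) = ?x b"
        using xc by (simp_all add: x_def hs(4) h_def inv_cancel_left)
      \<comment> \<open>Hence neither minimum in \<open>g1\<close> and \<open>g2\<close> is attained
        at the products of size \<open>D\<close>, and the product of \<open>?x a\<close> and
        \<open>?x b\<close> is at most \<open>2 * \<delta>\<close>.\<close>
      moreover have "real D > 2 * \<delta>"
        using k(2) mult_nonneg_nonneg[OF of_nat_0_le_iff delta_nonneg, of k] by (simp add: algebra_simps)
      ultimately show False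
        using ga gb' g1 g2 k(2) delta_nonneg
        by (auto simp: min_def algebra_simps split: if_splits)
    qed
  qed
  then show ?thesis
    unfolding geodesically_quasiconvex_def by blast
qed

end

section \<open>Projections to a quasiconvex subgroup\<close>

locale quasiconvex_in_hyperbolic = hyperbolic_generated_group +
  fixes H :: "'a set" and K :: real
  assumes subgroup_H: "subgroup H G" and quasiconvex_H: "geodesically_quasiconvex H K"
begin

lemmas H_carrier [simp] = subgroup.mem_carrier[OF subgroup_H]
lemmas H_mult [simp] = subgroup.m_closed[OF subgroup_H]
lemmas H_inv [simp] = subgroup.m_inv_closed[OF subgroup_H]
lemmas H_one [simp] = subgroup.one_closed[OF subgroup_H]

abbreviation proj where "proj \<equiv> nearest_point H"
abbreviation E where "E \<equiv> 2 * \<delta> + K + 1"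

text \<open>A relation besides the function \<open>proj\<close>, since an \<open>H\<close>-translate
  of a nearest point is again nearest but need not be the chosen one.\<close>

definition is_nearest :: "'a \<Rightarrow> 'a \<Rightarrow> bool" where
  "is_nearest y p \<longleftrightarrow> p \<in> H \<and> (\<forall>h\<in>H. d y p \<le> d y h)"

lemma is_nearest_proj: "is_nearest y (proj y)"
  unfolding is_nearest_def using nearest_point_in[OF subgroup_H] nearest_point_le by blast

lemma near_H:
  assumes "cayley_geodesic G X n p" "p 0 \<in> H" "p n \<in> H" "i \<le> n"
  obtains h where "h \<in> H" "d (p i) h \<le> K"
  using quasiconvex_H[unfolded geodesically_quasiconvex_def, rule_format, of n p i] assms by auto

lemma K_nonneg: "K \<ge> 0"
proof -
  have "cayley_geodesic G X 0 (\<lambda>_. \<one>)"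
    by (simp add: cayley_geodesic_def)
  then obtain h where "d \<one> h \<le> K"
    by (rule near_H[of 0 _ 0]) auto
  then show ?thesis
    using d_nonneg[of \<one> h] by linarith
qed

text \<open>The number \<open>d u (c 0) - gp (c 0) u (c n)\<close> is the Gromov product of the
  endpoints at \<open>u\<close>; it measures the distance from \<open>u\<close> to the geodesic up
  to an additive error.\<close>

lemma geodesic_shadow:
  assumes c: "cayley_geodesic G X n c" and u: "u \<in> carrier G"
  shows "\<exists>i\<le>n. d u (c i) \<le> d u (c 0) - gp (c 0) u (c n) + 1 + 2 * \<delta>"
proof -
  have cc: "c i \<in> carrier G" and cd: "d (c i) (c j) = \<bar>real i - real j\<bar>" if "i \<le> n" "j \<le> n" for i j
    using c that by (auto simp: cayley_geodesic_def)
  note cc0 = cc[of 0 0, simplified] and ccn = cc[of n n, simplified]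
  have "gp (c 0) u (c n) \<ge> 0"
    using d_triangle[of u "c 0" "c n"] d_commute[of "c 0" "c n"] u cc0 ccn
    by (simp add: gromov_product_def)
  moreover have le: "gp (c 0) u (c n) \<le> n"
    using d_triangle[of u "c n" "c 0"] u cc0 ccn cd[of n 0]
    by (simp add: gromov_product_def)
  \<comment> \<open>Vertices have integer parameters; rounding down costs the \<open>1\<close> in
    the bound.\<close>
  moreover define t where "t = nat \<lfloor>gp (c 0) u (c n)\<rfloor>"
  ultimately have t: "real t \<le> gp (c 0) u (c n)" "gp (c 0) u (c n) \<le> t + 1"
    by linarith+
  then have tn: "t \<le> n" using le by linarith
  have "gp (c 0) (c n) (c t) = t"
    using cd[of n 0] cd[of t 0] cd[of n t] tn by (simp add: gromov_product_def of_nat_diff)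
  then have "gp (c 0) u (c t) \<ge> t - \<delta>"
    using four_point[of "c 0" u "c n" "c t"] cc0 ccn cc[of t t] tn u t
    by (simp add: min_def split: if_splits)
  then have "d u (c t) \<le> d u (c 0) - t + 2 * \<delta>"
    using cd[of t 0] tn by (simp add: gromov_product_def)
  then show ?thesis
    using tn t by (intro exI[of _ t]) simp
qed

text \<open>With a large product, some point on the geodesic from \<open>p\<close> to
  \<open>h\<close> would be much closer to \<open>y\<close> than \<open>p\<close> is, and
  quasiconvexity would provide an element of \<open>H\<close> within \<open>K\<close> of it,
  contradicting the choice of \<open>p\<close>.\<close>

lemma gp_nearest_le:
  assumes y: "y \<in> carrier G" and p: "is_nearest y p" and h: "h \<in> H"
  shows "gp p y h \<le> E"
proof -
  have pH: "p \<in> H" using p by (simp add: is_nearest_def)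
  define n where "n = len (inv p \<otimes> h)"
  obtain c where c: "cayley_geodesic G X n c" "c 0 = p" "c n = h"
    using geodesic_exists[of p h] pH h unfolding n_def by auto
  obtain i where i: "i \<le> n" "d y (c i) \<le> d y p - gp p y h + 1 + 2 * \<delta>"
    using geodesic_shadow[OF c(1) y] c by auto
  obtain h' where h': "h' \<in> H" "d (c i) h' \<le> K"
    using near_H[OF c(1) _ _ i(1)] c pH h by auto
  have "c i \<in> carrier G" using c(1) i(1) by (simp add: cayley_geodesic_def)
  then have "d y p \<le> d y (c i) + d (c i) h'"
    using p h'(1) d_triangle[of y "c i" h'] y by (fastforce simp: is_nearest_def)
  then show ?thesis using i h' by simp
qed

text \<open>Sum of the bounds \<open>gp_nearest_le\<close> at \<open>p\<close> and at
  \<open>p'\<close>. For \<open>y = y'\<close> it says that nearest points are unique up to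
  \<open>2 * E\<close>.\<close>

lemma nearest_dist_le:
  assumes "y \<in> carrier G" "is_nearest y p" "y' \<in> carrier G" "is_nearest y' p'"
  shows "d p p' \<le> 2 * E + d y y'"
proof -
  have p: "p \<in> H" "p' \<in> H" using assms by (auto simp: is_nearest_def)
  have "gp p y p' \<le> E" "gp p' y' p \<le> E"
    using assms p by (auto intro!: gp_nearest_le)
  moreover have "d y p' \<le> d y y' + d y' p'" "d y' p \<le> d y' y + d y p"
    using assms p by (auto intro!: d_triangle)
  moreover have "d y' y = d y y'" "d p' p = d p p'"
    using assms p by (auto intro!: d_commute)
  ultimately show ?thesis
    by (simp add: gromov_product_def)
qed

lemma proj_in: "proj y \<in> H"
  by (rule nearest_point_in[OF subgroup_H])

lemma proj_dist_le:
  "y \<in> carrier G \<Longrightarrow> y' \<in> carrier G \<Longrightarrow> d (proj y) (proj y') \<le> 2 * E + d y y'"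
  by (intro nearest_dist_le is_nearest_proj)

text \<open>Left multiplication by \<open>b\<close> is an isometry that preserves
  \<open>H\<close>.\<close>

lemma is_nearest_translate:
  assumes y: "y \<in> carrier G" and b: "b \<in> H"
  shows "is_nearest (b \<otimes> y) (b \<otimes> proj y)"
  unfolding is_nearest_def
proof (intro conjI ballI)
  show "b \<otimes> proj y \<in> H" using b proj_in by simp
  fix h assume h: "h \<in> H"
  have "d (b \<otimes> y) (b \<otimes> proj y) = d y (proj y)"
    using b y proj_in by (simp add: d_translate)
  also have "\<dots> \<le> d y (inv b \<otimes> h)"
    using b h by (intro nearest_point_le) simp
  also have "\<dots> = d (b \<otimes> y) (b \<otimes> (inv b \<otimes> h))"
    using b h y by (simp add: d_translate)
  finally show "d (b \<otimes> y) (b \<otimes> proj y) \<le> d (b \<otimes> y) h"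
    using b h by (simp add: inv_cancel_left)
qed

lemma proj_translate:
  "y \<in> carrier G \<Longrightarrow> b \<in> H \<Longrightarrow> d (b \<otimes> proj y) (proj (b \<otimes> y)) \<le> 2 * E"
  using nearest_dist_le[OF _ is_nearest_translate[of y b] _ is_nearest_proj[of "b \<otimes> y"]] by simp

text \<open>A geodesic from \<open>y\<close> to \<open>y'\<close> must pass close to the middle of
  the geodesic between the two projections. Seen from \<open>c t\<close>, the points
  \<open>y\<close> and \<open>proj y\<close> lie in the same direction, likewise \<open>y'\<close>
  and \<open>proj y'\<close>, while the two projections lie in opposite directions.\<close>

lemma gp_between_projections:
  assumes y: "y \<in> carrier G" "y' \<in> carrier G"
    and c: "cayley_geodesic G X n c" "c 0 = proj y" "c n = proj y'"
    and t: "E + 3 * \<delta> < real t" "real t < real n - (E + 3 * \<delta>)"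
  shows "gp (c t) y y' \<le> 2 * \<delta>"
proof (rule ccontr)
  assume far: "\<not> ?thesis"
  define p p' q where "p = proj y" and "p' = proj y'" and "q = c t"
  have tn: "t \<le> n" using t delta_nonneg K_nonneg by simp
  have cd: "d (c i) (c j) = \<bar>real i - real j\<bar>" if "i \<le> n" "j \<le> n" for i j
    using c(1) that by (auto simp: cayley_geodesic_def)
  have q: "q \<in> carrier G" using c(1) tn by (simp add: q_def cayley_geodesic_def)
  have p: "p \<in> H" "p' \<in> H" by (simp_all add: p_def p'_def proj_in)
  have dd: "d p q = t" "d q p = t" "d q p' = n - t" "d p' q = n - t" "d p p' = n" "d p' p = n"
    using cd[of 0 t] cd[of t 0] cd[of t n] cd[of n t] cd[of 0 n] cd[of n 0] tn c
    by (simp_all add: p_def p'_def q_def of_nat_diff)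
  have comm: "d y p = d p y" "d y' p' = d p' y'" "d y q = d q y" "d y' q = d q y'"
    using y p q by (auto intro!: d_commute)
  have E1: "gp p y p' \<le> E" "gp p' y' p \<le> E"
    using gp_nearest_le y p is_nearest_proj by (auto simp: p_def p'_def)
  have "gp p q p' = t" "gp p' q p = n - t"
    using dd tn by (simp_all add: gromov_product_def of_nat_diff)
  \<comment> \<open>The distance \<open>t\<close> exceeds \<open>E + 3 * \<delta>\<close>: one
    \<open>\<delta>\<close> is lost here, and the other two are needed for the strict bounds by
    \<open>2 * \<delta>\<close> below.\<close>
  then have "gp p y q \<le> E + \<delta>" "gp p' y' q \<le> E + \<delta>"
    using four_point[of p y q p'] four_point[of p' y' q p] y p q E1 t tn delta_nonneg
    by (auto simp: min_def of_nat_diff split: if_splits)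
  moreover have "gp q p y = t - gp p y q" "gp q y' p' = (n - t) - gp p' y' q"
    using dd comm by (simp_all add: gromov_product_def field_simps)
  ultimately have "gp q p y > 2 * \<delta>" "gp q y' p' > 2 * \<delta>"
    using t tn by (simp_all add: of_nat_diff)
  moreover have "gp q p p' = 0"
    using dd tn by (simp add: gromov_product_def of_nat_diff)
  ultimately show False
    using four_point[of q p y p'] four_point[of q y y' p'] y p q far delta_nonneg
    by (auto simp: min_def q_def split: if_splits)
qed

text \<open>This is \<open>H \<inter> v H v\<^sup>-\<^sup>1\<close>, the stabilizer in
  \<open>H\<close> of the coset \<open>v H\<close> under left multiplication.\<close>

definition conj_inter :: "'a \<Rightarrow> 'a set" where
  "conj_inter v = {h \<in> H. inv v \<otimes> h \<otimes> v \<in> H}"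

lemma cayley_geodesic_translate:
  assumes "cayley_geodesic G X n p" "g \<in> carrier G"
  shows "cayley_geodesic G X n (\<lambda>i. g \<otimes> p i)"
  using assms by (simp add: cayley_geodesic_def d_translate)

text \<open>A coset with a large projection runs parallel to \<open>H\<close> for a long time; by the pigeonhole
  principle the same short element \<open>v\<close> then connects the two at two distant places.\<close>

theorem coset_projection_dichotomy:
  "\<exists>r B. \<forall>g\<in>carrier G.
     (\<forall>h\<in>H. \<forall>h'\<in>H. d (proj (g \<otimes> h)) (proj (g \<otimes> h')) \<le> B) \<or>
     (\<exists>a\<in>H. \<exists>b\<in>H. \<exists>v\<in>carrier G. len v \<le> r \<and> g = b \<otimes> v \<otimes> a \<and> infinite (conj_inter v))"
proof -
  \<comment> \<open>Sum of \<open>2 * \<delta>\<close> from \<open>gp_between_projections\<close>,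
    \<open>2 * \<delta> + 1\<close> from \<open>geodesic_shadow\<close>, and \<open>K\<close> for
    each of the two moves into \<open>H\<close> and into \<open>g H\<close>.\<close>
  define r where "r = nat \<lceil>4 * \<delta> + 1 + 2 * K\<rceil>"
  define V where "V = {v \<in> carrier G. len v \<le> r}"
  have V: "finite V" unfolding V_def by (rule finite_ball)
  \<comment> \<open>The set \<open>F\<close> collects the finite stabilizers of the short
    \<open>v\<close>; an element of \<open>conj_inter v\<close> longer than \<open>M\<close>
    therefore certifies that \<open>conj_inter v\<close> is infinite.\<close>
  define F where "F = (\<Union>v\<in>{v\<in>V. finite (conj_inter v)}. conj_inter v)"
  have F: "finite F" using V by (simp add: F_def)
  define M where "M = Max (insert 0 (len ` F))"
  have M: "len h \<le> M" if "h \<in> F" for h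
    unfolding M_def using F that by (intro Max_ge) auto
  \<comment> \<open>Spacing of the sample points: after moving two of them into \<open>H\<close>, at
    cost \<open>K\<close> each, more than \<open>M\<close> remains.\<close>
  define M' where "M' = M + nat \<lceil>2 * K\<rceil> + 1"
  define T where "T = nat \<lceil>E + 3 * \<delta>\<rceil> + 1"
  have T: "E + 3 * \<delta> < T" unfolding T_def by linarith
  define N where "N = card V"
  have "\<exists>a\<in>H. \<exists>b\<in>H. \<exists>v\<in>carrier G. len v \<le> r \<and> g = b \<otimes> v \<otimes> a \<and> infinite (conj_inter v)"
    if g: "g \<in> carrier G" and hh: "h \<in> H" "h' \<in> H"
      and large: "d (proj (g \<otimes> h)) (proj (g \<otimes> h')) > 2 * T + N * M'" for g h h'
  proof -
    let ?y = "g \<otimes> h" and ?y' = "g \<otimes> h'"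
    let ?p = "proj ?y" and ?p' = "proj ?y'"
    have y: "?y \<in> carrier G" "?y' \<in> carrier G" using g hh by auto
    define n where "n = len (inv ?p \<otimes> ?p')"
    obtain c where c: "cayley_geodesic G X n c" "c 0 = ?p" "c n = ?p'"
      using geodesic_exists[of ?p ?p'] proj_in unfolding n_def by auto
    have "real (2 * T + N * M') < real n" using large by (simp add: n_def word_dist_def)
    then have n: "n > 2 * T + N * M'" by (simp only: of_nat_less_iff)
    define m where "m = len (inv ?y \<otimes> ?y')"
    obtain e where e: "cayley_geodesic G X m e" "e 0 = ?y" "e m = ?y'"
      using geodesic_exists[of ?y ?y'] y unfolding m_def by auto
    let ?e = "\<lambda>i. inv g \<otimes> e i"
    have e': "cayley_geodesic G X m ?e" "?e 0 \<in> H" "?e m \<in> H"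
      using cayley_geodesic_translate[OF e(1)] e g hh by (simp_all add: inv_cancel_left)
    \<comment> \<open>There are \<open>N + 1\<close> sample points, one more than short elements,
      all at distance at least \<open>T\<close> from both ends of \<open>c\<close>.\<close>
    define t where "t i = T + i * M'" for i
    have cc: "c i \<in> carrier G" and cd: "d (c i) (c j) = \<bar>real i - real j\<bar>" if "i \<le> n" "j \<le> n" for i j
      using c(1) that by (auto simp: cayley_geodesic_def)
    have tn: "T \<le> t i" "t i + T < n" if "i \<le> N" for i
      using mult_le_mono1[OF that, of M'] n by (simp_all only: t_def le_add1)
    have "\<exists>a b. a \<in> H \<and> b \<in> H \<and> d b (c (t i)) \<le> K \<and> d b (g \<otimes> a) \<le> 4 * \<delta> + 1 + 2 * K"
      if i: "i \<le> N" for i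
    proof -
      let ?q = "c (t i)"
      have ti: "t i \<le> n" using tn[OF i] by simp
      have q: "?q \<in> carrier G" using cc[OF ti ti] .
      have "real (t i) \<ge> T" "real (t i) + T < n" using tn[OF i] by linarith+
      then have "gp ?q ?y ?y' \<le> 2 * \<delta>"
        using T by (intro gp_between_projections[OF y c]) auto
      moreover obtain j where j: "j \<le> m" "d ?q (e j) \<le> d ?q ?y - gp ?y ?q ?y' + 1 + 2 * \<delta>"
        using geodesic_shadow[OF e(1) q] e by auto
      moreover have "d ?q ?y - gp ?y ?q ?y' = gp ?q ?y ?y'"
        using d_commute[OF q y(1)] d_commute[OF q y(2)] d_commute[OF y]
        by (simp add: gromov_product_def field_simps)
      ultimately have qe: "d ?q (e j) \<le> 4 * \<delta> + 1" by simp
      obtain b where b: "b \<in> H" "d ?q b \<le> K"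
        using near_H[OF c(1) _ _ ti] c proj_in by auto
      obtain a where a: "a \<in> H" "d (?e j) a \<le> K"
        using near_H[OF e' j(1)] by auto
      have ej: "e j \<in> carrier G" using e(1) j by (simp add: cayley_geodesic_def)
      have "d (e j) (g \<otimes> a) \<le> K"
        using a g ej d_translate[of g "?e j" a] by (simp add: inv_cancel_left)
      then have "d b (g \<otimes> a) \<le> K + ((4 * \<delta> + 1) + K)"
        using d_triangle[of b ?q "g \<otimes> a"] d_triangle[of ?q "e j" "g \<otimes> a"] qe b a g ej q
          d_commute[of b ?q] by simp
      then show ?thesis
        using a b q d_commute[of b ?q] by (intro exI[of _ a] exI[of _ b]) simp
    qed
    then obtain a b where ab: "\<And>i. i \<le> N \<Longrightarrow> a i \<in> H" "\<And>i. i \<le> N \<Longrightarrow> b i \<in> H"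
      "\<And>i. i \<le> N \<Longrightarrow> d (b i) (c (t i)) \<le> K"
      "\<And>i. i \<le> N \<Longrightarrow> d (b i) (g \<otimes> a i) \<le> 4 * \<delta> + 1 + 2 * K"
      by metis
    define v where "v i = inv (b i) \<otimes> (g \<otimes> a i)" for i
    have vc: "v i \<in> carrier G" and vl: "len (v i) \<le> r" if "i \<le> N" for i
    proof -
      show "v i \<in> carrier G" using ab that g by (simp add: v_def)
      have "real (len (v i)) \<le> 4 * \<delta> + 1 + 2 * K"
        using ab(4)[OF that] by (simp add: v_def word_dist_def)
      then show "len (v i) \<le> r" unfolding r_def by linarith
    qed
    have "v ` {..N} \<subseteq> V" using vc vl by (auto simp: V_def)
    then have "card (v ` {..N}) \<le> N" unfolding N_def by (rule card_mono[OF V])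
    then have "\<not> inj_on v {..N}" by (intro pigeonhole) simp
    then obtain i j where ij: "i \<le> N" "j \<le> N" "i \<noteq> j" "v i = v j"
      by (auto simp: inj_on_def)
    note Hi = ab(1)[OF ij(1)] ab(2)[OF ij(1)] and Hj = ab(1)[OF ij(2)] ab(2)[OF ij(2)]
    let ?h = "inv (b j) \<otimes> b i"
    have "b i = g \<otimes> a i \<otimes> inv (v i)"
      using Hi g by (simp add: v_def group_normalize)
    \<comment> \<open>Both quotients \<open>b j\<close> to \<open>b i\<close> and \<open>a j\<close>
      to \<open>a i\<close> lie in \<open>H\<close>, and \<open>v i = v j\<close> conjugates one
      into the other.\<close>
    then have "inv (v j) \<otimes> ?h \<otimes> v j = inv (a j) \<otimes> a i"
      using Hi Hj g vc[OF ij(1)] ij(4) by (simp add: group_normalize v_def[of j])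
    then have hW: "?h \<in> conj_inter (v j)"
      using Hi Hj by (simp add: conj_inter_def)
    have "real M' \<le> \<bar>real (t i) - real (t j)\<bar>"
    proof -
      have "\<bar>real (t i) - real (t j)\<bar> = \<bar>real i - real j\<bar> * M'"
        by (simp add: t_def abs_mult flip: left_diff_distrib)
      moreover have "\<bar>real i - real j\<bar> \<ge> 1" using ij(3) by linarith
      ultimately show ?thesis
        using mult_right_mono[of 1 "\<bar>real i - real j\<bar>" "real M'"] by simp
    qed
    also have "\<dots> = d (c (t i)) (c (t j))"
      using cd[of "t i" "t j"] tn(2)[OF ij(1)] tn(2)[OF ij(2)] by simp
    also have "\<dots> \<le> d (c (t i)) (b i) + (d (b i) (b j) + d (b j) (c (t j)))"
      using d_triangle[of "c (t i)" "b i" "c (t j)"] d_triangle[of "b i" "b j" "c (t j)"]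
        cc[of "t i" "t i"] cc[of "t j" "t j"] tn(2)[OF ij(1)] tn(2)[OF ij(2)] Hi Hj by simp
    also have "d (c (t i)) (b i) = d (b i) (c (t i))"
      using cc[of "t i" "t i"] tn(2)[OF ij(1)] Hi by (intro d_commute) auto
    also have "d (b i) (b j) = len ?h"
      using Hi Hj d_commute[of "b i" "b j"] by (simp add: word_dist_def)
    finally have "real M' \<le> 2 * K + len ?h"
      using ab(3)[OF ij(1)] ab(3)[OF ij(2)] by simp
    then have "M < len ?h" unfolding M'_def by linarith
    then have "?h \<notin> F" using M[of ?h] by auto
    moreover have "v j \<in> V" using vc vl ij by (simp add: V_def)
    ultimately have "infinite (conj_inter (v j))" using hW by (auto simp: F_def)
    moreover have "g = b j \<otimes> v j \<otimes> inv (a j)"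
      using Hj g by (simp add: v_def group_normalize)
    ultimately show ?thesis
      using vc[OF ij(2)] vl[OF ij(2)] Hj by (metis H_inv)
  qed
  then show ?thesis
    by (intro exI[of _ r] exI[of _ "real (2 * T + N * M')"]) (meson not_le)
qed

end

section \<open>Constructing extensions\<close>

text \<open>The maps are restricted to \<open>M\<close> because the elements of
  \<open>BijGroup M\<close> are extensional functions.\<close>

lemma group_actionI:
  fixes G :: "('g, 'm) monoid_scheme" (structure)
  assumes "group G"
    and closed: "\<And>g x. g \<in> carrier G \<Longrightarrow> x \<in> M \<Longrightarrow> f g x \<in> M"
    and one: "\<And>x. x \<in> M \<Longrightarrow> f \<one> x = x"
    and mult: "\<And>g h x. g \<in> carrier G \<Longrightarrow> h \<in> carrier G \<Longrightarrow> x \<in> M \<Longrightarrow> f (g \<otimes> h) x = f g (f h x)"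
  shows "group_action G M (\<lambda>g. \<lambda>x\<in>M. f g x)"
proof -
  interpret group G by fact
  have bij: "(\<lambda>x\<in>M. f g x) \<in> Bij M" if g: "g \<in> carrier G" for g
  proof -
    have "bij_betw (\<lambda>x\<in>M. f g x) M M"
    proof (rule bij_betw_byWitness[where f' = "f (inv g)"])
      show "\<forall>a\<in>M. f (inv g) ((\<lambda>x\<in>M. f g x) a) = a"
        using g one mult[of "inv g" g] by simp
      show "\<forall>a\<in>M. (\<lambda>x\<in>M. f g x) (f (inv g) a) = a"
        using g one closed mult[of g "inv g"] by simp
    qed (use g closed in auto)
    then show ?thesis by (simp add: Bij_def)
  qed
  have "(\<lambda>g. \<lambda>x\<in>M. f g x) \<in> hom G (BijGroup M)"
  proof (rule homI)
    fix g h assume gh: "g \<in> carrier G" "h \<in> carrier G"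
    have "(\<lambda>x\<in>M. f (g \<otimes> h) x) = compose M (\<lambda>x\<in>M. f g x) (\<lambda>x\<in>M. f h x)"
      using gh closed mult by (auto simp: compose_def restrict_def)
    then show "(\<lambda>x\<in>M. f (g \<otimes> h) x) = (\<lambda>x\<in>M. f g x) \<otimes>\<^bsub>BijGroup M\<^esub> (\<lambda>x\<in>M. f h x)"
      using bij gh by (simp add: BijGroup_def)
  qed (use bij in \<open>simp add: BijGroup_def\<close>)
  then show ?thesis
    by (simp add: group_action_def group_hom_def group_hom_axioms_def group_BijGroup is_group)
qed

text \<open>Adding the discrete metric turns the pseudometric \<open>\<rho>\<close> into a metric without any quotient.\<close>

lemma isometric_action_on_product:
  fixes G :: "('g, 'm) monoid_scheme" (structure) and R :: "'r set"
  defines "S \<equiv> carrier G \<times> R"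
  assumes "group G"
    and nonneg: "\<And>x y. x \<in> S \<Longrightarrow> y \<in> S \<Longrightarrow> 0 \<le> \<rho> x y"
    and commute: "\<And>x y. x \<in> S \<Longrightarrow> y \<in> S \<Longrightarrow> \<rho> x y = \<rho> y x"
    and triangle: "\<And>x y z. x \<in> S \<Longrightarrow> y \<in> S \<Longrightarrow> z \<in> S \<Longrightarrow> \<rho> x z \<le> \<rho> x y + \<rho> y z"
    and invariant: "\<And>g k r k' r'. g \<in> carrier G \<Longrightarrow> (k, r) \<in> S \<Longrightarrow> (k', r') \<in> S \<Longrightarrow>
      \<rho> (g \<otimes> k, r) (g \<otimes> k', r') = \<rho> (k, r) (k', r')"
  shows "isometric_action G S (\<lambda>x y. if x = y \<or> x \<notin> S \<or> y \<notin> S then 0 else 1 + \<rho> x y)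
    (\<lambda>g. \<lambda>x\<in>S. (g \<otimes> fst x, snd x))"
  unfolding isometric_action_def
proof (intro conjI ballI)
  interpret group G by fact
  \<comment> \<open>The value 0 outside \<open>S\<close> secures nonnegativity and symmetry, which
    \<open>Metric_space\<close> demands of all arguments.\<close>
  let ?d = "\<lambda>x y. if x = y \<or> x \<notin> S \<or> y \<notin> S then 0 else 1 + \<rho> x y"
  have pos: "1 + \<rho> x y > 0" if "x \<in> S" "y \<in> S" for x y
    using nonneg[OF that] by simp
  show "Metric_space S ?d"
  proof
    fix x y z assume xyz: "x \<in> S" "y \<in> S" "z \<in> S"
    show "?d x z \<le> ?d x y + ?d y z"
      using triangle[OF xyz] pos[OF xyz(1,2)] pos[OF xyz(2,3)] xyz by auto
    show "?d x y = 0 \<longleftrightarrow> x = y"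
      using pos[OF xyz(1,2)] xyz by auto
  next
    fix x y
    show "0 \<le> ?d x y" using pos[of x y] by auto
    show "?d x y = ?d y x" using commute[of x y] by auto
  qed
  show "group_action G S (\<lambda>g. \<lambda>x\<in>S. (g \<otimes> fst x, snd x))"
    by (rule group_actionI) (auto simp: S_def m_assoc group_axioms)
  fix g x y assume "g \<in> carrier G" "x \<in> S" "y \<in> S"
  then show "?d ((\<lambda>x\<in>S. (g \<otimes> fst x, snd x)) x) ((\<lambda>x\<in>S. (g \<otimes> fst x, snd x)) y) = ?d x y"
    using invariant[of g "fst x" "snd x" "fst y" "snd y"] by (auto simp: S_def)
qed

text \<open>A family of functions \<open>\<Phi> t\<close> on \<open>G \<times> R\<close> replaces
  the distance functions of \<open>R\<close>, and the supremum of the differences of their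
  translates is the pseudometric. The function with \<open>t = y\<close> at \<open>\<one>\<close> is
  the distance to \<open>y\<close> and gives the lower bound; the Lipschitz constant
  \<open>K\<close> in \<open>r\<close> gives the upper one. The invariance \<open>shift\<close> puts
  \<open>(\<one>, \<phi> h r)\<close> and \<open>(h, r)\<close> at distance zero, and comparison
  with \<open>\<sigma>\<close> makes the supremum finite.\<close>

lemma extension_by_orbit_map:
  fixes G :: "('g, 'm) monoid_scheme" (structure) and R :: "'r set"
  assumes "group G" and H: "subgroup H G"
    and act: "isometric_action (G\<lparr>carrier := H\<rparr>) R dR \<phi>" and r0: "r0 \<in> R"
    and \<sigma>: "\<And>g. g \<in> carrier G \<Longrightarrow> \<sigma> g \<in> R"
    and \<sigma>_H: "\<And>h. h \<in> H \<Longrightarrow> \<sigma> h = \<phi> h r0"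
    and \<sigma>_bornologous: "\<And>x. x \<in> carrier G \<Longrightarrow> \<exists>\<beta>. \<forall>g\<in>carrier G. dR (\<sigma> g) (\<sigma> (g \<otimes> x)) \<le> \<beta>"
    and \<sigma>_coset: "\<And>g h. g \<in> carrier G \<Longrightarrow> h \<in> H \<Longrightarrow>
      dR (\<sigma> g) (\<sigma> (g \<otimes> h)) \<le> K * dR r0 (\<phi> h r0) + K"
    and K: "K \<ge> 1"
  shows "\<exists>(S :: ('g \<times> 'r) set) dS \<psi>. is_extension G H R dR \<phi> S dS \<psi>"
proof -
  interpret group G by fact
  interpret R: Metric_space R dR using act by (simp add: isometric_action_def)
  interpret A: group_action "G\<lparr>carrier := H\<rparr>" R \<phi> using act by (simp add: isometric_action_def)
  note Hc [simp] = subgroup.mem_carrier[OF H]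
  note Hm [simp] = subgroup.m_closed[OF H]
  note Hi [simp] = subgroup.m_inv_closed[OF H]
  note H1 [simp] = subgroup.one_closed[OF H]
  have \<phi>R [simp]: "\<phi> h x \<in> R" if "h \<in> H" "x \<in> R" for h x
    using A.element_image[of h x] that by simp
  have \<phi>m: "\<phi> (h \<otimes> k) x = \<phi> h (\<phi> k x)" if "h \<in> H" "k \<in> H" "x \<in> R" for h k x
    using A.composition_rule[of x h k] that by simp
  have \<phi>1: "\<phi> \<one> x = x" if "x \<in> R" for x
    using A.id_eq_one that by simp (metis restrict_apply')
  have isom: "dR (\<phi> h x) (\<phi> h y) = dR x y" if "h \<in> H" "x \<in> R" "y \<in> R" for h x y
    using act that by (simp add: isometric_action_def)

  text \<open>Outside \<open>H\<close>, the distance function to \<open>t\<close> is transported by \<open>\<sigma>\<close> to the orbit of \<open>r0\<close> and then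
    extended to \<open>R\<close> by McShane's formula.\<close>

  define \<Psi> where "\<Psi> t g r h = K * dR r (\<phi> h r0) + dR (\<sigma> (g \<otimes> h)) t" for t g r h
  define \<Phi> where "\<Phi> t g r = (if g \<in> H then dR (\<phi> g r) t else (INF h\<in>H. \<Psi> t g r h))" for t g r
  have bdd: "bdd_below (\<Psi> t g r ` H)" for t g r
    using K by (intro bdd_belowI2[of _ 0]) (simp add: \<Psi>_def)
  have ne: "H \<noteq> {}" using H1 by blast
  have lip_le: "\<Phi> t g r \<le> \<Phi> t g r' + K * dR r r'"
    if "g \<in> carrier G" "t \<in> R" "r \<in> R" "r' \<in> R" for t g r r'
  proof (cases "g \<in> H")
    case True
    have "dR (\<phi> g r) t \<le> dR (\<phi> g r) (\<phi> g r') + dR (\<phi> g r') t"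
      using that True by (intro R.triangle) auto
    also have "dR (\<phi> g r) (\<phi> g r') \<le> K * dR r r'"
      using isom that True K mult_right_mono[of 1 K "dR r r'"] by simp
    finally show ?thesis using True by (simp add: \<Phi>_def)
  next
    case False
    have "(INF h\<in>H. \<Psi> t g r h) - K * dR r r' \<le> (INF h\<in>H. \<Psi> t g r' h)"
    proof (rule cINF_greatest[OF ne])
      fix h assume h: "h \<in> H"
      have "(INF h\<in>H. \<Psi> t g r h) \<le> \<Psi> t g r h"
        using h by (intro cINF_lower bdd)
      also have "K * dR r (\<phi> h r0) \<le> K * (dR r r' + dR r' (\<phi> h r0))"
        using h that r0 K by (intro mult_left_mono R.triangle) auto
      then have "\<Psi> t g r h \<le> \<Psi> t g r' h + K * dR r r'"
        by (simp add: \<Psi>_def algebra_simps)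
      finally show "(INF h\<in>H. \<Psi> t g r h) - K * dR r r' \<le> \<Psi> t g r' h" by simp
    qed
    then show ?thesis using False by (simp add: \<Phi>_def)
  qed
  have lip: "\<bar>\<Phi> t g r - \<Phi> t g r'\<bar> \<le> K * dR r r'"
    if "g \<in> carrier G" "t \<in> R" "r \<in> R" "r' \<in> R" for t g r r'
    using lip_le[OF that] lip_le[OF that(1,2,4,3)] by (simp add: R.commute)
  \<comment> \<open>For \<open>g\<close> outside \<open>H\<close>, reindexing the infimum by left
    multiplication with \<open>h\<close> matches the two families term by term.\<close>
  have shift: "\<Phi> t g (\<phi> h r) = \<Phi> t (g \<otimes> h) r"
    if g: "g \<in> carrier G" and h: "h \<in> H" and r: "r \<in> R" for t g h r
  proof (cases "g \<in> H")
    case True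
    then show ?thesis using h r by (simp add: \<Phi>_def \<phi>m)
  next
    case False
    then have gh: "g \<otimes> h \<notin> H"
      using g h Hm[of "g \<otimes> h" "inv h"] by (auto simp: m_assoc)
    have img: "(\<lambda>k. h \<otimes> k) ` H = H"
    proof (intro subset_antisym subsetI)
      fix k assume "k \<in> H"
      then show "k \<in> (\<lambda>k. h \<otimes> k) ` H"
        using h by (intro image_eqI[of _ _ "inv h \<otimes> k"]) (auto simp: inv_cancel_left)
    qed (use h in auto)
    have "\<Psi> t g (\<phi> h r) (h \<otimes> k) = \<Psi> t (g \<otimes> h) r k" if "k \<in> H" for k
      using that g h r r0 by (simp add: \<Psi>_def \<phi>m isom m_assoc)
    then have "\<Psi> t (g \<otimes> h) r ` H = (\<lambda>k. \<Psi> t g (\<phi> h r) (h \<otimes> k)) ` H"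
      by (intro image_cong) auto
    also have "\<dots> = \<Psi> t g (\<phi> h r) ` H"
      by (subst (2) img[symmetric]) (simp add: image_image)
    finally show ?thesis
      using False gh by (simp add: \<Phi>_def)
  qed
  \<comment> \<open>The term \<open>h = \<one>\<close> gives one inequality; the coset condition on
    \<open>\<sigma>\<close> says that no other term is smaller by more than
    \<open>K\<close>.\<close>
  have base: "\<bar>\<Phi> t g r0 - dR (\<sigma> g) t\<bar> \<le> K" if g: "g \<in> carrier G" and t: "t \<in> R" for t g
  proof (cases "g \<in> H")
    case True
    then show ?thesis using K by (simp add: \<Phi>_def \<sigma>_H)
  next
    case False
    have "(INF h\<in>H. \<Psi> t g r0 h) \<le> \<Psi> t g r0 \<one>"
      by (intro cINF_lower bdd) simp
    also have "\<dots> = dR (\<sigma> g) t"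
      using r0 g by (simp add: \<Psi>_def \<phi>1)
    finally have "(INF h\<in>H. \<Psi> t g r0 h) \<le> dR (\<sigma> g) t" .
    moreover have "dR (\<sigma> g) t - K \<le> (INF h\<in>H. \<Psi> t g r0 h)"
    proof (rule cINF_greatest[OF ne])
      fix h assume h: "h \<in> H"
      have "dR (\<sigma> g) t \<le> dR (\<sigma> g) (\<sigma> (g \<otimes> h)) + dR (\<sigma> (g \<otimes> h)) t"
        using g h t by (intro R.triangle \<sigma>) auto
      then show "dR (\<sigma> g) t - K \<le> \<Psi> t g r0 h"
        using \<sigma>_coset[OF g h] by (simp add: \<Psi>_def)
    qed
    ultimately show ?thesis using False K by (simp add: \<Phi>_def)
  qed

  \<comment> \<open>The invariant pseudometric\<close>
  define S where "S = carrier G \<times> R"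
  define D where "D x y kt = \<bar>\<Phi> (snd kt) (fst kt \<otimes> fst x) (snd x) - \<Phi> (snd kt) (fst kt \<otimes> fst y) (snd y)\<bar>"
    for x y kt
  define \<rho> where "\<rho> x y = (SUP kt\<in>S. D x y kt)" for x y
  have D_bdd: "bdd_above (D x y ` S)" if xy: "x \<in> S" "y \<in> S" for x y
  proof -
    obtain g r g' r' where xy': "x = (g, r)" "y = (g', r')"
      and gr: "g \<in> carrier G" "r \<in> R" "g' \<in> carrier G" "r' \<in> R"
      using xy by (auto simp: S_def)
    \<comment> \<open>Since \<open>k \<otimes> g'\<close> is \<open>k \<otimes> g\<close> times the
      fixed element \<open>inv g \<otimes> g'\<close>, the bound does not depend on the index
      \<open>k\<close>.\<close>
    obtain \<beta> where \<beta>: "\<And>k. k \<in> carrier G \<Longrightarrow> dR (\<sigma> k) (\<sigma> (k \<otimes> (inv g \<otimes> g'))) \<le> \<beta>"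
      using \<sigma>_bornologous[of "inv g \<otimes> g'"] gr by auto
    show ?thesis
    proof (rule bdd_aboveI2)
      fix kt assume "kt \<in> S"
      then obtain k t where kt: "kt = (k, t)" "k \<in> carrier G" "t \<in> R" by (auto simp: S_def)
      have "\<bar>\<Phi> t (k \<otimes> g) r - \<Phi> t (k \<otimes> g) r0\<bar> \<le> K * dR r r0"
        "\<bar>\<Phi> t (k \<otimes> g') r' - \<Phi> t (k \<otimes> g') r0\<bar> \<le> K * dR r' r0"
        using gr kt r0 by (intro lip; simp)+
      moreover have "\<bar>\<Phi> t (k \<otimes> g) r0 - dR (\<sigma> (k \<otimes> g)) t\<bar> \<le> K"
        "\<bar>\<Phi> t (k \<otimes> g') r0 - dR (\<sigma> (k \<otimes> g')) t\<bar> \<le> K"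
        using gr kt by (intro base; simp)+
      moreover have "dR (\<sigma> (k \<otimes> g)) (\<sigma> (k \<otimes> g')) \<le> \<beta>"
        using \<beta>[of "k \<otimes> g"] gr kt by (simp add: group_normalize)
      then have "\<bar>dR (\<sigma> (k \<otimes> g)) t - dR (\<sigma> (k \<otimes> g')) t\<bar> \<le> \<beta>"
        using R.triangle[of "\<sigma> (k \<otimes> g)" "\<sigma> (k \<otimes> g')" t] R.triangle[of "\<sigma> (k \<otimes> g')" "\<sigma> (k \<otimes> g)" t]
          gr kt \<sigma> by (simp add: R.commute)
      ultimately show "D x y kt \<le> K * dR r r0 + K * dR r' r0 + 2 * K + \<beta>"
        by (simp add: D_def xy' kt(1))
    qed
  qed
  have Sne: "S \<noteq> {}" using r0 by (auto simp: S_def)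
  have D_le: "D x y kt \<le> \<rho> x y" if "x \<in> S" "y \<in> S" "kt \<in> S" for x y kt
    unfolding \<rho>_def using that by (intro cSUP_upper D_bdd)
  have \<rho>_le: "\<rho> x y \<le> b" if "\<And>kt. kt \<in> S \<Longrightarrow> D x y kt \<le> b" for x y b
    unfolding \<rho>_def using that by (intro cSUP_least Sne)
  have inv_le: "\<rho> (g \<otimes> k, r) (g \<otimes> k', r') \<le> \<rho> (k, r) (k', r')"
    if g: "g \<in> carrier G" and k: "(k, r) \<in> S" "(k', r') \<in> S" for g k r k' r'
  proof (rule \<rho>_le)
    fix kt assume kt: "kt \<in> S"
    \<comment> \<open>Translating both points by \<open>g\<close> only translates the index over
      which the supremum is taken.\<close>
    then have "D (g \<otimes> k, r) (g \<otimes> k', r') kt = D (k, r) (k', r') (fst kt \<otimes> g, snd kt)"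
      using g k by (auto simp: D_def S_def m_assoc)
    also have "\<dots> \<le> \<rho> (k, r) (k', r')"
      using kt g by (intro D_le k) (auto simp: S_def)
    finally show "D (g \<otimes> k, r) (g \<otimes> k', r') kt \<le> \<rho> (k, r) (k', r')" .
  qed
  let ?dS = "\<lambda>x y. if x = y \<or> x \<notin> S \<or> y \<notin> S then 0 else 1 + \<rho> x y"
  let ?\<psi> = "\<lambda>g. \<lambda>x\<in>S. (g \<otimes> fst x, snd x)"
  obtain kt0 where kt0: "kt0 \<in> S" using Sne by blast
  have \<rho>_nonneg: "0 \<le> \<rho> x y" if "x \<in> S" "y \<in> S" for x y
    using D_le[OF that kt0] by (simp add: D_def)
  have "isometric_action G S ?dS ?\<psi>"
    unfolding S_def
  proof (rule isometric_action_on_product, unfold S_def[symmetric])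
    fix x y z assume xyz: "x \<in> S" "y \<in> S" "z \<in> S"
    show "\<rho> x z \<le> \<rho> x y + \<rho> y z"
    proof (rule \<rho>_le)
      fix kt assume "kt \<in> S"
      then show "D x z kt \<le> \<rho> x y + \<rho> y z"
        using D_le[OF xyz(1,2), of kt] D_le[OF xyz(2,3), of kt] by (simp add: D_def)
    qed
  next
    fix g k r k' r' assume *: "g \<in> carrier G" "(k, r) \<in> S" "(k', r') \<in> S"
    then have c: "k \<in> carrier G" "k' \<in> carrier G" by (auto simp: S_def)
    show "\<rho> (g \<otimes> k, r) (g \<otimes> k', r') = \<rho> (k, r) (k', r')"
    proof (rule antisym[OF inv_le[OF *]])
      have "\<rho> (inv g \<otimes> (g \<otimes> k), r) (inv g \<otimes> (g \<otimes> k'), r') \<le> \<rho> (g \<otimes> k, r) (g \<otimes> k', r')"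
        using * by (intro inv_le) (auto simp: S_def)
      then show "\<rho> (k, r) (k', r') \<le> \<rho> (g \<otimes> k, r) (g \<otimes> k', r')"
        using *(1) c by (simp add: inv_cancel_left)
    qed
  qed (use \<rho>_nonneg in \<open>auto simp: \<rho>_def D_def abs_minus_commute group_axioms\<close>)
  moreover have "quasi_isometric_embedding R dR S ?dS (Pair \<one>)"
    unfolding quasi_isometric_embedding_def
  proof (intro conjI exI[of _ "K + 1"] ballI)
    show "Pair \<one> \<in> R \<rightarrow> S" by (simp add: S_def)
    show "0 < K + 1" using K by simp
    fix x y assume xy: "x \<in> R" "y \<in> R"
    then have S: "(\<one>, x) \<in> S" "(\<one>, y) \<in> S" by (auto simp: S_def)
    \<comment> \<open>At the index \<open>(\<one>, y)\<close> the two values are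
      \<open>dR x y\<close> and \<open>dR y y = 0\<close>.\<close>
    have "dR x y \<le> D (\<one>, x) (\<one>, y) (\<one>, y)"
      using xy by (simp add: D_def \<Phi>_def \<phi>1)
    also have "\<dots> \<le> \<rho> (\<one>, x) (\<one>, y)" by (intro D_le S)
    finally have low: "dR x y \<le> \<rho> (\<one>, x) (\<one>, y)" .
    have up: "\<rho> (\<one>, x) (\<one>, y) \<le> K * dR x y"
    proof (rule \<rho>_le)
      fix kt assume "kt \<in> S"
      then show "D (\<one>, x) (\<one>, y) kt \<le> K * dR x y"
        using lip xy by (auto simp: D_def S_def)
    qed
    have "1 / (K + 1) * dR x y \<le> dR x y"
      using K mult_right_mono[of "1 / (K + 1)" 1 "dR x y"] by simp
    then show "1 / (K + 1) * dR x y - (K + 1) \<le> ?dS (\<one>, x) (\<one>, y)"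
      using low K S xy by auto
    have "(K + 1) * dR x y + (K + 1) = K * dR x y + (dR x y + K + 1)" "0 \<le> dR x y" "0 \<le> K * dR x y"
      using K by (simp_all add: algebra_simps)
    then have "1 + \<rho> (\<one>, x) (\<one>, y) \<le> (K + 1) * dR x y + (K + 1)" "0 \<le> (K + 1) * dR x y + (K + 1)"
      using up K by linarith+
    then show "?dS (\<one>, x) (\<one>, y) \<le> (K + 1) * dR x y + (K + 1)"
      by auto
  qed
  moreover have "coarsely_equivariant H R \<phi> ?dS ?\<psi> (Pair \<one>)"
    unfolding coarsely_equivariant_def
  proof
    fix x assume x: "x \<in> R"
    show "bdd_above ((\<lambda>h. ?dS (\<one>, \<phi> h x) (?\<psi> h (\<one>, x))) ` H)"
    proof (rule bdd_aboveI2)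
      fix h assume h: "h \<in> H"
      \<comment> \<open>All differences vanish by \<open>shift\<close>, so only the discrete part of
        the metric remains and 1 is a uniform bound.\<close>
      have "\<rho> (\<one>, \<phi> h x) (h, x) \<le> 0"
      proof (rule \<rho>_le)
        fix kt assume "kt \<in> S"
        then show "D (\<one>, \<phi> h x) (h, x) kt \<le> 0"
          using shift[of "fst kt" h x] h x by (auto simp: D_def S_def)
      qed
      then show "?dS (\<one>, \<phi> h x) (?\<psi> h (\<one>, x)) \<le> 1"
        using h x by (auto simp: S_def)
    qed
  qed
  ultimately show ?thesis
    unfolding is_extension_def by blast
qed

section \<open>Solvability of the extension problem implies quasiconvexity\<close>

context generated_group
begin

text \<open>The constant is the largest displacement of \<open>s\<close> by a letter; along a
  shortest word these displacements add up.\<close>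

lemma orbit_growth:
  assumes act: "isometric_action G S dS \<psi>" and s: "s \<in> S"
  shows "\<exists>A::real. A \<ge> 0 \<and> (\<forall>g\<in>carrier G. dS s (\<psi> g s) \<le> A * len g)"
proof -
  interpret S: Metric_space S dS using act by (simp add: isometric_action_def)
  interpret A: group_action G S \<psi> using act by (simp add: isometric_action_def)
  have cl: "\<psi> g x \<in> S" if "g \<in> carrier G" "x \<in> S" for g x
    using A.element_image[OF that] by simp
  define A where "A = Max (insert 0 ((\<lambda>x. dS s (\<psi> x s)) ` letters))"
  have A: "dS s (\<psi> x s) \<le> A" if "x \<in> letters" for x
    unfolding A_def using that finite_letters by (intro Max_ge) auto
  have A0: "A \<ge> 0" unfolding A_def using finite_letters by (intro Max_ge) auto
  have *: "dS s (\<psi> (word_value G ws) s) \<le> A * length ws" if "set ws \<subseteq> letters" for ws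
    using that
  proof (induction ws)
    case Nil
    have "\<psi> \<one> s = s"
      using fun_cong[OF A.id_eq_one, of s] s by simp
    then show ?case using s by simp
  next
    case (Cons w ws)
    then have w: "w \<in> carrier G" and u: "word_value G ws \<in> carrier G" (is "?u \<in> _")
      using letters_subset word_value_closed[of ws] by auto
    have "dS s (\<psi> (w \<otimes> ?u) s) = dS s (\<psi> w (\<psi> ?u s))"
      using A.composition_rule[OF s w u] by simp
    also have "\<dots> \<le> dS s (\<psi> w s) + dS (\<psi> w s) (\<psi> w (\<psi> ?u s))"
      by (intro S.triangle s cl w u)
    also have "dS (\<psi> w s) (\<psi> w (\<psi> ?u s)) = dS s (\<psi> ?u s)"
      using act s w cl[OF u s] by (simp add: isometric_action_def)
    finally show ?case
      using Cons A[of w] by (simp add: algebra_simps)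
  qed
  have "dS s (\<psi> g s) \<le> A * len g" if g: "g \<in> carrier G" for g
  proof -
    obtain ws where ws: "set ws \<subseteq> letters" "word_value G ws = g" "length ws = len g"
      using ex_shortest_word[OF g] .
    from *[OF ws(1)] show ?thesis by (simp only: ws(2,3))
  qed
  with A0 show ?thesis by (intro exI[of _ A] conjI ballI)
qed

text \<open>The action of \<open>H\<close> on itself that is extended carries the word metric of the infinite
  generating set \<open>H\<close>, in which \<open>k\<close> has the superlinear weight \<open>(len k)\<^sup>2 + 1\<close>.\<close>

definition weight :: "'a \<Rightarrow> nat" where
  "weight k = (len k)\<^sup>2 + 1"

definition weighted_length :: "'a set \<Rightarrow> 'a \<Rightarrow> nat" where
  "weighted_length H h =
     (LEAST m. \<exists>hs. set hs \<subseteq> H \<and> word_value G hs = h \<and> sum_list (map weight hs) = m)"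

lemma weighted_length_le:
  "set hs \<subseteq> H \<Longrightarrow> weighted_length H (word_value G hs) \<le> sum_list (map weight hs)"
  unfolding weighted_length_def by (rule Least_le) blast

lemma weighted_length_attained:
  assumes "h \<in> H" "H \<subseteq> carrier G"
  obtains hs where "set hs \<subseteq> H" "word_value G hs = h" "sum_list (map weight hs) = weighted_length H h"
proof -
  have "\<exists>m hs. set hs \<subseteq> H \<and> word_value G hs = h \<and> sum_list (map weight hs) = m"
    using assms by (intro exI[of _ "weight h"] exI[of _ "[h]"]) auto
  from LeastI_ex[OF this] show ?thesis
    using that unfolding weighted_length_def by blast
qed

text \<open>Symmetry holds because \<open>weight\<close> is invariant under inversion, definiteness
  because the summand \<open>+ 1\<close> gives every factor positive weight.\<close>

lemma weighted_length_isometric_action: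
  assumes H: "subgroup H G"
  defines "dH \<equiv> \<lambda>x y. if x \<in> H \<and> y \<in> H then real (weighted_length H (inv x \<otimes> y)) else 0"
  shows "isometric_action (G\<lparr>carrier := H\<rparr>) H dH (\<lambda>h. \<lambda>x\<in>H. h \<otimes> x)"
  unfolding isometric_action_def
proof (intro conjI ballI)
  note Hc [simp] = subgroup.mem_carrier[OF H]
  note Hm [simp] = subgroup.m_closed[OF H]
  note Hi [simp] = subgroup.m_inv_closed[OF H]
  have HG: "H \<subseteq> carrier G" by (rule subgroup.subset[OF H])
  let ?N = "weighted_length H"
  have N_mult: "?N (x \<otimes> y) \<le> ?N x + ?N y" if xy: "x \<in> H" "y \<in> H" for x y
  proof -
    obtain us where us: "set us \<subseteq> H" "word_value G us = x" "sum_list (map weight us) = ?N x"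
      using weighted_length_attained[OF xy(1) HG] .
    obtain vs where vs: "set vs \<subseteq> H" "word_value G vs = y" "sum_list (map weight vs) = ?N y"
      using weighted_length_attained[OF xy(2) HG] .
    show ?thesis
      using weighted_length_le[of "us @ vs" H] us vs HG word_value_append[of us vs]
      by (simp del: foldr_append)
  qed
  have N_inv: "?N (inv x) \<le> ?N x" if x: "x \<in> H" for x
  proof -
    obtain us where us: "set us \<subseteq> H" "word_value G us = x" "sum_list (map weight us) = ?N x"
      using weighted_length_attained[OF x HG] .
    have "map (weight \<circ> m_inv G) us = map weight us"
      using us(1) by (auto simp: weight_def)
    then have "sum_list (map weight (rev (map (m_inv G) us))) = ?N x"
      using us(3) by (simp add: rev_map[symmetric] sum_list_rev del: map_eq_conv)
    moreover have "set (rev (map (m_inv G) us)) \<subseteq> H" using us(1) by auto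
    moreover have "word_value G (rev (map (m_inv G) us)) = inv x"
      using word_value_rev_inv[of us] us HG by simp
    ultimately show ?thesis
      using weighted_length_le by metis
  qed
  have N_0: "?N x = 0 \<longleftrightarrow> x = \<one>" if x: "x \<in> H" for x
  proof
    assume "?N x = 0"
    moreover obtain us where "word_value G us = x" "sum_list (map weight us) = ?N x"
      using weighted_length_attained[OF x HG] .
    ultimately show "x = \<one>" by (cases us) (auto simp: weight_def)
  next
    assume "x = \<one>"
    then show "?N x = 0" using weighted_length_le[of "[]" H] by simp
  qed
  show "Metric_space H dH"
  proof
    fix x y
    show "0 \<le> dH x y" by (simp add: dH_def)
    have "?N (inv x \<otimes> y) = ?N (inv y \<otimes> x)" if "x \<in> H" "y \<in> H"
      using that N_inv[of "inv x \<otimes> y"] N_inv[of "inv y \<otimes> x"] by (simp add: inv_mult_group)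
    then show "dH x y = dH y x" by (simp add: dH_def)
  next
    fix x y assume xy: "x \<in> H" "y \<in> H"
    have "inv x \<otimes> y = \<one> \<longleftrightarrow> x = y"
      using xy by (metis Hc inv_cancel_left(2) inv_closed l_inv r_one)
    then show "dH x y = 0 \<longleftrightarrow> x = y"
      using xy N_0 by (simp add: dH_def)
  next
    fix x y z assume xyz: "x \<in> H" "y \<in> H" "z \<in> H"
    then have "inv x \<otimes> z = (inv x \<otimes> y) \<otimes> (inv y \<otimes> z)"
      by (simp add: group_normalize)
    then have "?N (inv x \<otimes> z) \<le> ?N (inv x \<otimes> y) + ?N (inv y \<otimes> z)"
      using N_mult[of "inv x \<otimes> y" "inv y \<otimes> z"] xyz by simp
    then show "dH x z \<le> dH x y + dH y z"
      using xyz by (simp add: dH_def)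
  qed
  show "group_action (G\<lparr>carrier := H\<rparr>) H (\<lambda>h. \<lambda>x\<in>H. h \<otimes> x)"
    using group_actionI[where G = "G\<lparr>carrier := H\<rparr>" and M = H and f = "\<lambda>h x. h \<otimes> x"]
      subgroup_imp_group[OF H] by (simp add: m_assoc)
  fix h x y assume "h \<in> carrier (G\<lparr>carrier := H\<rparr>)" "x \<in> H" "y \<in> H"
  then show "dH ((\<lambda>x\<in>H. h \<otimes> x) x) ((\<lambda>x\<in>H. h \<otimes> x) y) = dH x y"
    by (simp add: dH_def group_normalize)
qed

text \<open>In a decomposition of \<open>h\<close> of weight at most \<open>Q * len h\<close>, every factor \<open>k\<close> longer than \<open>Q\<close>
  is shorter than \<open>h\<close>, and its weight pays for \<open>Q * len k\<close> short factors.\<close>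

lemma undistorted_if_weighted_length_le:
  assumes H: "subgroup H G" and Q: "\<And>h. h \<in> H \<Longrightarrow> weighted_length H h \<le> Q * len h"
  shows "undistorted H"
proof -
  have HG: "H \<subseteq> carrier G" by (rule subgroup.subset[OF H])
  have "\<exists>hs. set hs \<subseteq> H \<and> (\<forall>k\<in>set hs. len k \<le> Q) \<and> length hs \<le> Q * len h \<and> word_value G hs = h"
    if "h \<in> H" for h
    using that
  proof (induction "len h" arbitrary: h rule: less_induct)
    case less
    obtain ks where ks: "set ks \<subseteq> H" "word_value G ks = h"
      "sum_list (map weight ks) = weighted_length H h"
      using weighted_length_attained[OF less.prems HG] .
    have sum: "sum_list (map weight ks) \<le> Q * len h" using Q[OF less.prems] ks(3) by simp
    have "\<exists>hs. set hs \<subseteq> H \<and> (\<forall>k\<in>set hs. len k \<le> Q) \<and> length hs \<le> weight k \<and> word_value G hs = k"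
      if k: "k \<in> set ks" for k
    proof (cases "len k \<le> Q")
      case True
      then show ?thesis
        using k ks(1) HG by (intro exI[of _ "[k]"]) (auto simp: weight_def)
    next
      case False
      have "Q * len k \<le> len k * len k"
        using False by (intro mult_le_mono1) simp
      then have *: "Q * len k < weight k"
        unfolding weight_def power2_eq_square by linarith
      have "weight k \<le> Q * len h"
        using sum member_le_sum_list[of "weight k" "map weight ks"] k by simp
      with * have "len k < len h"
        by (meson less_le_trans mult_less_cancel1)
      moreover have "k \<in> H" using k ks(1) by auto
      ultimately obtain hs where "set hs \<subseteq> H" "\<forall>k\<in>set hs. len k \<le> Q"
        "length hs \<le> Q * len k" "word_value G hs = k"
        using less.hyps by blast
      then show ?thesis
        using * by (intro exI[of _ hs]) simp
    qed
    then obtain F where F: "\<And>k. k \<in> set ks \<Longrightarrow> set (F k) \<subseteq> H \<and> (\<forall>k\<in>set (F k). len k \<le> Q) \<and>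
        length (F k) \<le> weight k \<and> word_value G (F k) = k"
      by metis
    have "length (concat (map F ks)) \<le> sum_list (map weight ks)"
      unfolding length_concat map_map using F by (intro sum_list_mono) auto
    moreover have "word_value G (concat (map F ks)) = h"
      using word_value_concat[of ks F] F HG ks(2) by blast
    moreover have "set (concat (map F ks)) \<subseteq> H" "\<forall>k\<in>set (concat (map F ks)). len k \<le> Q"
      using F by auto
    ultimately show ?case
      using sum le_trans by blast
  qed
  then show ?thesis
    unfolding undistorted_def by blast
qed

text \<open>Displacement in an extension is at most linear in \<open>len\<close>, and the
  quasi-isometric embedding bounds the weighted length by this displacement. The space acted on is
  \<open>H\<close> itself, hence solvability over the type of the group elements suffices.\<close>

lemma extension_solvable_imp_undistorted:
  assumes H: "subgroup H G" and solv: "extension_problem_solvable TYPE('a) G H"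
  shows "undistorted H"
proof -
  note Hc [simp] = subgroup.mem_carrier[OF H]
  note H1 [simp] = subgroup.one_closed[OF H]
  let ?N = "weighted_length H"
  let ?dH = "\<lambda>x y. if x \<in> H \<and> y \<in> H then real (?N (inv x \<otimes> y)) else 0"
  let ?\<phi> = "\<lambda>h. \<lambda>x\<in>H. h \<otimes> x"
  obtain S :: "('a \<times> 'a) set" and dS \<psi> where ext: "is_extension G H H ?dH ?\<phi> S dS \<psi>"
    using solv weighted_length_isometric_action[OF H] unfolding extension_problem_solvable_def by blast
  then obtain f where act: "isometric_action G S dS \<psi>"
    and qi: "quasi_isometric_embedding H ?dH S dS f"
    and eqv: "coarsely_equivariant H H ?\<phi> dS \<psi> f"
    unfolding is_extension_def by blast
  interpret S: Metric_space S dS using act by (simp add: isometric_action_def)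
  interpret A: group_action G S \<psi> using act by (simp add: isometric_action_def)
  obtain C where f: "f \<in> H \<rightarrow> S" and C: "C > 0"
    and low: "\<And>x y. x \<in> H \<Longrightarrow> y \<in> H \<Longrightarrow> 1 / C * ?dH x y - C \<le> dS (f x) (f y)"
    using qi unfolding quasi_isometric_embedding_def by blast
  have fS: "f h \<in> S" if "h \<in> H" for h using f that by blast
  obtain A :: real where A: "A \<ge> 0" "\<And>g. g \<in> carrier G \<Longrightarrow> dS (f \<one>) (\<psi> g (f \<one>)) \<le> A * len g"
    using orbit_growth[OF act fS[OF H1]] by blast
  have "bdd_above ((\<lambda>h. dS (f (?\<phi> h \<one>)) (\<psi> h (f \<one>))) ` H)"
    by (rule bspec[OF eqv[unfolded coarsely_equivariant_def] H1])
  then obtain B where "\<And>h. h \<in> H \<Longrightarrow> dS (f (?\<phi> h \<one>)) (\<psi> h (f \<one>)) \<le> B"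
    by (auto simp: bdd_above_def)
  then have B: "dS (f h) (\<psi> h (f \<one>)) \<le> B" if "h \<in> H" for h
    using that by fastforce
  define Q where "Q = nat \<lceil>C * (A + \<bar>B\<bar> + C)\<rceil>"
  have "?N h \<le> Q * len h" if h: "h \<in> H" for h
  \<comment> \<open>For \<open>h \<noteq> \<one>\<close> the additive constants are absorbed using
    \<open>len h \<ge> 1\<close>.\<close>
  proof (cases "h = \<one>")
    case True
    then show ?thesis using weighted_length_le[of "[]" H] by simp
  next
    case False
    then have len: "len h \<ge> 1" using len_eq_0[of h] h by simp
    have "dS (f \<one>) (f h) \<le> dS (f \<one>) (\<psi> h (f \<one>)) + dS (\<psi> h (f \<one>)) (f h)"
      using A.element_image[of h "f \<one>" "\<psi> h (f \<one>)"] h fS by (intro S.triangle) auto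
    also have "\<dots> \<le> A * len h + \<bar>B\<bar>"
      using A(2)[of h] B[OF h] h S.commute[of "\<psi> h (f \<one>)" "f h"] by simp
    finally have "1 / C * ?N h - C \<le> A * len h + \<bar>B\<bar>"
      using low[OF H1 h] h by simp
    then have "1 / C * ?N h \<le> A * len h + (\<bar>B\<bar> + C)" by simp
    also have "\<dots> \<le> A * len h + (\<bar>B\<bar> + C) * len h"
      using len C mult_left_mono[of 1 "real (len h)" "\<bar>B\<bar> + C"] by simp
    finally have "?N h \<le> C * (A + \<bar>B\<bar> + C) * len h"
      using C by (simp add: field_simps)
    also have "\<dots> \<le> real Q * len h"
      unfolding Q_def by (intro mult_right_mono) linarith+
    finally show ?thesis
      by (simp only: of_nat_le_iff flip: of_nat_mult)
  qed
  then show ?thesis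
    by (rule undistorted_if_weighted_length_le[OF H])
qed

end

section \<open>Quasiconvex subgroups with solvable extension problem\<close>

locale quasiconvex_with_action = quasiconvex_in_hyperbolic +
  fixes R :: "'r set" and dR \<phi> r0
  assumes act: "isometric_action (G\<lparr>carrier := H\<rparr>) R dR \<phi>" and r0: "r0 \<in> R"
begin

sublocale R: Metric_space R dR
  using act by (simp add: isometric_action_def)

sublocale A: group_action "G\<lparr>carrier := H\<rparr>" R \<phi>
  using act by (simp add: isometric_action_def)

abbreviation orb :: "'a \<Rightarrow> 'r" where "orb h \<equiv> \<phi> h r0"
abbreviation \<sigma> :: "'a \<Rightarrow> 'r" where "\<sigma> g \<equiv> orb (proj g)"

lemma phi_closed [simp]: "h \<in> H \<Longrightarrow> x \<in> R \<Longrightarrow> \<phi> h x \<in> R"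
  using A.element_image[of h x] by simp

lemma phi_mult: "h \<in> H \<Longrightarrow> k \<in> H \<Longrightarrow> x \<in> R \<Longrightarrow> \<phi> (h \<otimes> k) x = \<phi> h (\<phi> k x)"
  using A.composition_rule[of x h k] by simp

lemma phi_one: "x \<in> R \<Longrightarrow> \<phi> \<one> x = x"
  using fun_cong[OF A.id_eq_one, of x] by simp

lemma phi_isometry: "h \<in> H \<Longrightarrow> x \<in> R \<Longrightarrow> y \<in> R \<Longrightarrow> dR (\<phi> h x) (\<phi> h y) = dR x y"
  using act by (simp add: isometric_action_def)

lemma orb_dist_translate:
  "h \<in> H \<Longrightarrow> k \<in> H \<Longrightarrow> l \<in> H \<Longrightarrow> dR (orb (l \<otimes> h)) (orb (l \<otimes> k)) = dR (orb h) (orb k)"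
  by (simp add: phi_mult phi_isometry r0)

lemma orb_dist: "h \<in> H \<Longrightarrow> k \<in> H \<Longrightarrow> dR (orb h) (orb k) = dR r0 (orb (inv h \<otimes> k))"
  using orb_dist_translate[of \<one> "inv h \<otimes> k" h] by (simp add: inv_cancel_left phi_one r0)

text \<open>By invariance only the quotient \<open>inv h \<otimes> k\<close> matters, and it ranges
  over a finite ball.\<close>

lemma orb_bornologous:
  obtains \<gamma> where "\<gamma> \<ge> 0" "\<And>h k. h \<in> H \<Longrightarrow> k \<in> H \<Longrightarrow> d h k \<le> s \<Longrightarrow> dR (orb h) (orb k) \<le> \<gamma>"
proof -
  let ?B = "{x \<in> carrier G. len x \<le> nat \<lfloor>s\<rfloor>}"
  let ?I = "insert 0 ((\<lambda>x. dR r0 (orb x)) ` ?B)"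
  have fin: "finite ?I" using finite_ball by simp
  have "dR (orb h) (orb k) \<le> Max ?I" if "h \<in> H" "k \<in> H" "d h k \<le> s" for h k
  proof -
    have "len (inv h \<otimes> k) \<le> nat \<lfloor>s\<rfloor>"
      using that(3) by (simp add: word_dist_def) linarith
    then have "inv h \<otimes> k \<in> ?B" using that by simp
    then show ?thesis
      unfolding orb_dist[OF that(1,2)] by (intro Max_ge fin) blast
  qed
  moreover have "0 \<le> Max ?I" by (intro Max_ge fin) simp
  ultimately show ?thesis using that by blast
qed

text \<open>Coarse equivariance of the projection, carried over to \<open>R\<close> by the orbit
  map.\<close>

lemma sigma_translate:
  obtains \<gamma> where "\<gamma> \<ge> 0" "\<And>b y. b \<in> H \<Longrightarrow> y \<in> carrier G \<Longrightarrow> dR (\<phi> b (\<sigma> y)) (\<sigma> (b \<otimes> y)) \<le> \<gamma>"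
proof -
  obtain \<gamma> where \<gamma>: "\<gamma> \<ge> 0" "\<And>h k. h \<in> H \<Longrightarrow> k \<in> H \<Longrightarrow> d h k \<le> 2 * E \<Longrightarrow> dR (orb h) (orb k) \<le> \<gamma>"
    by (rule orb_bornologous[of "2 * E"]) (rule that)
  have "dR (\<phi> b (\<sigma> y)) (\<sigma> (b \<otimes> y)) \<le> \<gamma>" if "b \<in> H" "y \<in> carrier G" for b y
    using \<gamma>(2)[of "b \<otimes> proj y" "proj (b \<otimes> y)"] proj_translate[of y b] that proj_in
    by (simp add: phi_mult r0)
  with \<gamma>(1) show ?thesis using that by blast
qed

lemma sigma_closed [simp]: "\<sigma> g \<in> R"
  by (simp add: proj_in r0)

text \<open>Cosets with bounded projection satisfy the condition of
  \<open>extension_by_orbit_map\<close> by a constant. By the dichotomy every other coset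
  representative is \<open>b \<otimes> v \<otimes> a\<close> with \<open>v\<close> short;
  \<open>b\<close> can be moved out of \<open>\<sigma>\<close> at bounded cost and \<open>a\<close>
  changes no distance in the orbit, which reduces the condition to finitely many
  \<open>v\<close>.\<close>

lemma extension_if_parallel_cosets:
  assumes parallel: "\<And>v. v \<in> carrier G \<Longrightarrow> infinite (conj_inter v) \<Longrightarrow>
    \<exists>\<kappa>. \<forall>h\<in>H. \<forall>h'\<in>H. dR (\<sigma> (v \<otimes> h)) (\<sigma> (v \<otimes> h')) \<le> \<kappa> + dR (orb h) (orb h')"
  shows "\<exists>(S :: ('a \<times> 'r) set) dS \<psi>. is_extension G H R dR \<phi> S dS \<psi>"
proof -
  obtain r B where rB: "\<And>g. g \<in> carrier G \<Longrightarrow>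
     (\<forall>h\<in>H. \<forall>h'\<in>H. d (proj (g \<otimes> h)) (proj (g \<otimes> h')) \<le> B) \<or>
     (\<exists>a\<in>H. \<exists>b\<in>H. \<exists>v\<in>carrier G. len v \<le> r \<and> g = b \<otimes> v \<otimes> a \<and> infinite (conj_inter v))"
    using coset_projection_dichotomy by blast
  obtain \<gamma>B where \<gamma>B: "\<gamma>B \<ge> 0" "\<And>h k. h \<in> H \<Longrightarrow> k \<in> H \<Longrightarrow> d h k \<le> B \<Longrightarrow> dR (orb h) (orb k) \<le> \<gamma>B"
    by (rule orb_bornologous[of B]) (rule that)
  obtain \<gamma> where \<gamma>: "\<gamma> \<ge> 0" "\<And>b y. b \<in> H \<Longrightarrow> y \<in> carrier G \<Longrightarrow> dR (\<phi> b (\<sigma> y)) (\<sigma> (b \<otimes> y)) \<le> \<gamma>"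
    by (rule sigma_translate) (rule that)
  obtain \<kappa> where \<kappa>: "\<And>v h h'. v \<in> carrier G \<Longrightarrow> infinite (conj_inter v) \<Longrightarrow> h \<in> H \<Longrightarrow> h' \<in> H \<Longrightarrow>
      dR (\<sigma> (v \<otimes> h)) (\<sigma> (v \<otimes> h')) \<le> \<kappa> v + dR (orb h) (orb h')"
    using parallel by metis
  define M where "M = Max (insert 0 (\<kappa> ` {v \<in> carrier G. len v \<le> r}))"
  have M: "\<kappa> v \<le> M" if "v \<in> carrier G" "len v \<le> r" for v
    unfolding M_def using that finite_ball by (intro Max_ge) auto
  \<comment> \<open>The term \<open>2 * \<gamma>\<close> pays for moving \<open>b\<close> out of
    \<open>\<sigma>\<close> at both points.\<close>
  define C where "C = 1 + \<bar>\<gamma>B\<bar> + \<bar>M\<bar> + 2 * \<gamma>"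
  show ?thesis
  proof (rule extension_by_orbit_map[OF group_axioms subgroup_H act r0, where \<sigma> = \<sigma> and K = C])
    show "C \<ge> 1" using \<gamma>(1) by (simp add: C_def)
    fix g x assume "x \<in> carrier G"
    obtain \<beta> where \<beta>: "\<beta> \<ge> 0" "\<And>h k. h \<in> H \<Longrightarrow> k \<in> H \<Longrightarrow> d h k \<le> 2 * E + len x \<Longrightarrow> dR (orb h) (orb k) \<le> \<beta>"
      by (rule orb_bornologous[of "2 * E + len x"]) (rule that)
    show "\<exists>\<beta>. \<forall>g\<in>carrier G. dR (\<sigma> g) (\<sigma> (g \<otimes> x)) \<le> \<beta>"
    proof (intro exI ballI)
      fix g assume "g \<in> carrier G"
      with \<open>x \<in> carrier G\<close> show "dR (\<sigma> g) (\<sigma> (g \<otimes> x)) \<le> \<beta>"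
        using proj_dist_le[of g "g \<otimes> x"] d_mult_right[of g x] by (intro \<beta>(2) proj_in) simp
    qed
  next
    fix g h assume g: "g \<in> carrier G" and h: "h \<in> H"
    have nn: "0 \<le> C * dR r0 (orb h)" "dR r0 (orb h) \<le> C * dR r0 (orb h)"
      using \<gamma>(1) mult_right_mono[of 1 C "dR r0 (orb h)"] by (simp_all add: C_def)
    show "dR (\<sigma> g) (\<sigma> (g \<otimes> h)) \<le> C * dR r0 (orb h) + C"
      using rB[OF g]
    proof (elim disjE bexE conjE)
      assume "\<forall>h\<in>H. \<forall>h'\<in>H. d (proj (g \<otimes> h)) (proj (g \<otimes> h')) \<le> B"
      from bspec[OF bspec[OF this H_one] h]
      have "d (proj (g \<otimes> \<one>)) (proj (g \<otimes> h)) \<le> B" .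
      then have "dR (\<sigma> g) (\<sigma> (g \<otimes> h)) \<le> \<gamma>B"
        using g by (intro \<gamma>B(2) proj_in) simp
      moreover have "\<gamma>B \<le> C" using \<gamma>(1) by (simp add: C_def)
      ultimately show ?thesis using nn(1) by linarith
    next
      fix a b v assume abv: "a \<in> H" "b \<in> H" "v \<in> carrier G" "len v \<le> r" "g = b \<otimes> v \<otimes> a"
        "infinite (conj_inter v)"
      have "dR (\<phi> b (\<sigma> (v \<otimes> a))) (\<phi> b (\<sigma> (v \<otimes> (a \<otimes> h)))) = dR (\<sigma> (v \<otimes> a)) (\<sigma> (v \<otimes> (a \<otimes> h)))"
        using abv by (simp add: phi_isometry)
      also have "\<dots> \<le> \<kappa> v + dR (orb a) (orb (a \<otimes> h))"
        using abv h by (intro \<kappa>) auto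
      also have "dR (orb a) (orb (a \<otimes> h)) = dR r0 (orb h)"
        using abv h by (simp add: orb_dist inv_cancel_left)
      finally have mid: "dR (\<phi> b (\<sigma> (v \<otimes> a))) (\<phi> b (\<sigma> (v \<otimes> (a \<otimes> h)))) \<le> M + dR r0 (orb h)"
        using M[OF abv(3,4)] by simp
      have "dR (\<phi> b (\<sigma> (v \<otimes> a))) (\<sigma> g) \<le> \<gamma>" "dR (\<phi> b (\<sigma> (v \<otimes> (a \<otimes> h)))) (\<sigma> (g \<otimes> h)) \<le> \<gamma>"
        using \<gamma>(2)[of b "v \<otimes> a"] \<gamma>(2)[of b "v \<otimes> (a \<otimes> h)"] abv h by (simp_all add: m_assoc)
      then have "dR (\<sigma> g) (\<sigma> (g \<otimes> h)) \<le> 2 * \<gamma> + (M + dR r0 (orb h))"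
        using mid abv(2) R.commute[of "\<sigma> g"]
          R.triangle[of "\<sigma> g" "\<phi> b (\<sigma> (v \<otimes> a))" "\<sigma> (g \<otimes> h)"]
          R.triangle[of "\<phi> b (\<sigma> (v \<otimes> a))" "\<phi> b (\<sigma> (v \<otimes> (a \<otimes> h)))" "\<sigma> (g \<otimes> h)"] by simp
      moreover have "2 * \<gamma> + M \<le> C" by (simp add: C_def)
      ultimately show ?thesis using nn(2) by linarith
    qed
  qed (simp_all add: nearest_point_id[OF subgroup_H])
qed

text \<open>An infinite \<open>conj_inter v\<close> forces \<open>v \<in> H\<close>, and on
  \<open>H\<close> the map \<open>\<sigma>\<close> is the orbit map itself.\<close>

lemma extension_if_almost_malnormal:
  assumes mal: "almost_malnormal G H"
  shows "\<exists>(S :: ('a \<times> 'r) set) dS \<psi>. is_extension G H R dR \<phi> S dS \<psi>"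
proof (rule extension_if_parallel_cosets)
  fix v assume v: "v \<in> carrier G" and inf: "infinite (conj_inter v)"
  \<comment> \<open>Almost malnormality conjugates by the inverse on the left, so it is applied to
    \<open>inv v\<close>.\<close>
  have "conj_inter v \<subseteq> H \<inter> (inv (inv v) <# H #> inv v)"
  proof
    fix h assume "h \<in> conj_inter v"
    then have h: "h \<in> H" "inv v \<otimes> h \<otimes> v \<in> H" by (auto simp: conj_inter_def)
    moreover have "h = v \<otimes> (inv v \<otimes> h \<otimes> v) \<otimes> inv v"
      using h(1) v by (simp add: group_normalize)
    ultimately show "h \<in> H \<inter> (inv (inv v) <# H #> inv v)"
      using v unfolding r_coset_def l_coset_def by force
  qed
  then have "infinite (H \<inter> (inv (inv v) <# H #> inv v))"
    using inf finite_subset by blast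
  then have "inv v \<in> H"
    using mal v unfolding almost_malnormal_def by blast
  then have "v \<in> H" using v H_inv[of "inv v"] by simp
  then show "\<exists>\<kappa>. \<forall>h\<in>H. \<forall>h'\<in>H. dR (\<sigma> (v \<otimes> h)) (\<sigma> (v \<otimes> h')) \<le> \<kappa> + dR (orb h) (orb h')"
    by (intro exI[of _ 0]) (simp add: nearest_point_id[OF subgroup_H] orb_dist_translate)
qed

end

section \<open>Virtually cyclic subgroups\<close>

text \<open>Here \<open>a\<close> generates the cyclic subgroup of finite index and \<open>F\<close>
  represents its right cosets in \<open>H\<close>.\<close>

lemma (in group) virtually_cyclic_subgroup_normal_form:
  assumes H: "subgroup H G" and vc: "virtually_cyclic (G\<lparr>carrier := H\<rparr>)"
  obtains a F where "a \<in> H" "finite F" "F \<subseteq> H"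
    "\<And>h. h \<in> H \<Longrightarrow> \<exists>i::int. \<exists>f\<in>F. h = a [^] i \<otimes> f"
proof -
  obtain C where C: "subgroup C (G\<lparr>carrier := H\<rparr>)" "cyclic_group (G\<lparr>carrier := C\<rparr>)"
    and fin: "finite (rcosets\<^bsub>G\<lparr>carrier := H\<rparr>\<^esub> C)"
    using vc unfolding virtually_cyclic_def by auto
  have CG: "subgroup C G" by (rule incl_subgroup[OF H C(1)])
  interpret C: group "G\<lparr>carrier := C\<rparr>" by (rule subgroup_imp_group[OF CG])
  obtain a where a: "a \<in> C" "C = range (\<lambda>n::int. a [^]\<^bsub>G\<lparr>carrier := C\<rparr>\<^esub> n)"
    using C(2) unfolding C.cyclic_group by auto
  have pow: "\<exists>i::int. c = a [^] i" if "c \<in> C" for c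
    using that a int_pow_consistent[OF CG a(1)] by auto
  have CH: "C \<subseteq> H" using subgroup.subset[OF C(1)] by simp
  have rc: "rcosets\<^bsub>G\<lparr>carrier := H\<rparr>\<^esub> C = (\<lambda>h. C #> h) ` H"
    by (auto simp: RCOSETS_def)
  obtain F where F: "F \<subseteq> H" "finite F" "(\<lambda>h. C #> h) ` H = (\<lambda>h. C #> h) ` F"
    using finite_subset_image[OF fin[unfolded rc] subset_refl] by blast
  have "\<exists>i::int. \<exists>f\<in>F. h = a [^] i \<otimes> f" if h: "h \<in> H" for h
  proof -
    have "C #> h \<in> (\<lambda>h. C #> h) ` F" using F(3) h by blast
    then obtain f where f: "f \<in> F" "C #> h = C #> f" by blast
    have "h \<in> C #> f"
      using rcos_self[OF subgroup.mem_carrier[OF H h] CG] by (simp only: f(2))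
    then obtain c where c: "c \<in> C" "h = c \<otimes> f"
      by (auto simp: r_coset_def)
    obtain i :: int where "c = a [^] i" using pow[OF c(1)] by blast
    then show ?thesis using c(2) f(1) by (intro exI[of _ i] bexI[of _ f]) simp_all
  qed
  then show ?thesis
    by (intro that[OF subsetD[OF CH a(1)] F(2,1)])
qed

lemma (in group) conjugate_int_pow:
  assumes "v \<in> carrier G" "x \<in> carrier G"
  shows "(v \<otimes> x \<otimes> inv v) [^] (n::int) = v \<otimes> x [^] n \<otimes> inv v"
proof -
  have "(\<lambda>x. v \<otimes> x \<otimes> inv v) \<in> hom G G"
    using assms(1) by (intro homI) (simp_all add: group_normalize)
  from hom_int_pow[OF this assms(2) group_axioms group_axioms, of n] show ?thesis by simp
qed

lemma (in group) finite_powers_if_not_inj: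
  assumes a: "a \<in> carrier G" and "\<not> inj (\<lambda>i::int. a [^] i)"
  shows "finite (range (\<lambda>i::int. a [^] i))"
proof -
  obtain i j :: int where "a [^] i = a [^] j" "i < j"
    using assms(2) by (metis injI linorder_neqE)
  define m where "m = j - i"
  have "a [^] m = \<one>"
    using a \<open>a [^] i = a [^] j\<close> by (simp add: m_def int_pow_diff)
  have m: "m > 0" using \<open>i < j\<close> by (simp add: m_def)
  have "a [^] n = a [^] (n mod m)" for n
  proof -
    have "a [^] n = a [^] (m * (n div m) + n mod m)" by simp
    also have "\<dots> = a [^] (n mod m)"
      unfolding int_pow_mult[OF a] int_pow_pow[OF a, symmetric] \<open>a [^] m = \<one>\<close>
      using a by simp
    finally show ?thesis .
  qed
  then have "range (\<lambda>i::int. a [^] i) \<subseteq> (\<lambda>i. a [^] i) ` {0..<m}"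
    using m by (auto intro!: image_eqI[of _ _ "_ mod m"])
  then show ?thesis by (rule finite_subset) simp
qed

text \<open>An element of infinite order in an undistorted subgroup has no conjugates of the form
  \<open>a\<^sup>p = v a\<^sup>q v\<^sup>-\<^sup>1\<close> with \<open>|p| \<noteq> |q|\<close>: iterating would distort \<open>a\<close> exponentially, as in
  the Baumslag--Solitar groups. The function \<open>l\<close> is the length of the powers of \<open>a\<close>.\<close>

lemma abs_le_if_no_distortion:
  fixes l :: "int \<Rightarrow> real" and p q :: int
  assumes conj: "\<And>m. l (p * m) \<le> l (q * m) + b" and b: "b \<ge> 0"
    and low: "\<And>n. \<bar>real_of_int n\<bar> \<le> c * (l n + 1)" and c: "c \<ge> 0"
    and up: "\<And>n. l n \<le> A * \<bar>real_of_int n\<bar>" and A: "A \<ge> 0"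
    and q: "q \<noteq> 0"
  shows "\<bar>p\<bar> \<le> \<bar>q\<bar>"
proof (rule ccontr)
  assume "\<not> \<bar>p\<bar> \<le> \<bar>q\<bar>"
  then have pq: "\<bar>q\<bar> < \<bar>p\<bar>" by simp
  \<comment> \<open>The factors \<open>p\<close> are exchanged for \<open>q\<close> one at a time,
    at cost \<open>b\<close> each; \<open>m\<close> is arbitrary so that it can take up the factors
    \<open>q\<close> already produced.\<close>
  have iter: "l (p ^ k * m) \<le> l (q ^ k * m) + k * b" for k m
  proof (induction k arbitrary: m)
    case (Suc k)
    have "l (p ^ Suc k * m) = l (p * (p ^ k * m))" by (simp add: mult.assoc)
    also have "\<dots> \<le> l (q * (p ^ k * m)) + b" by (rule conj)
    also have "q * (p ^ k * m) = p ^ k * (q * m)" by (simp add: mult.left_commute)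
    also have "l (p ^ k * (q * m)) \<le> l (q ^ k * (q * m)) + k * b" by (rule Suc)
    also have "q ^ k * (q * m) = q ^ Suc k * m" by (simp add: mult.assoc mult.left_commute)
    finally show ?case by (simp add: algebra_simps)
  qed simp
  define x y where "x = \<bar>real_of_int p\<bar>" and "y = \<bar>real_of_int q\<bar>"
  have y: "y \<ge> 1" and xy: "y < x"
    using q pq by (simp_all add: x_def y_def)
  have bound: "(x / y) ^ k \<le> c * (A + 1) + c * b * k" for k :: nat
  proof -
    have yk: "y ^ k \<ge> 1" using y by (rule one_le_power)
    have "x ^ k = \<bar>real_of_int (p ^ k * 1)\<bar>" by (simp add: x_def power_abs)
    also have "\<dots> \<le> c * (l (p ^ k * 1) + 1)" by (rule low)
    also have "l (p ^ k * 1) \<le> l (q ^ k * 1) + k * b" by (rule iter)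
    also have "l (q ^ k * 1) \<le> A * y ^ k"
      using up[of "q ^ k * 1"] by (simp add: y_def power_abs)
    finally have "x ^ k \<le> c * (A * y ^ k + k * b + 1)" using c by (simp add: mult_left_mono)
    \<comment> \<open>The linear terms are enlarged by \<open>y ^ k \<ge> 1\<close> so that dividing
      by \<open>y ^ k\<close> leaves a linear bound on the geometric sequence.\<close>
    also have "\<dots> \<le> c * (A * y ^ k + (k * b + 1) * y ^ k)"
      using yk b mult_left_mono[of 1 "y ^ k" "k * b + 1"] c by (intro mult_left_mono) auto
    finally show ?thesis
      using yk by (simp add: power_divide divide_le_eq algebra_simps)
  qed
  define z where "z = x / y"
  have z: "z > 1" using xy y by (simp add: z_def)
  have "(\<lambda>k::nat. c * (A + 1) * (1 / z) ^ k + c * b * (k * (1 / z) ^ k)) \<longlonglongrightarrow> c * (A + 1) * 0 + c * b * 0"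
    using z by (intro tendsto_add tendsto_mult_left LIMSEQ_realpow_zero powser_times_n_limit_0) auto
  then have "\<forall>\<^sub>F k::nat in sequentially. c * (A + 1) * (1 / z) ^ k + c * b * (k * (1 / z) ^ k) < 1"
    by (rule order_tendstoD) simp
  then obtain k :: nat where "c * (A + 1) * (1 / z) ^ k + c * b * (k * (1 / z) ^ k) < 1"
    by (auto dest: eventually_happens)
  then have "(c * (A + 1) * (1 / z) ^ k + c * b * (k * (1 / z) ^ k)) * z ^ k < 1 * z ^ k"
    using z by (intro mult_strict_right_mono) auto
  moreover have "(1 / z) ^ k * z ^ k = 1"
    using z by (simp add: power_divide)
  ultimately have "c * (A + 1) + c * b * k < z ^ k"
    by (simp only: distrib_right mult.assoc) simp
  with bound[of k] show False by (simp add: z_def)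
qed

section \<open>Distortion of powers\<close>

context generated_group
begin

lemma len_int_pow_le:
  fixes n :: int
  assumes a: "a \<in> carrier G"
  shows "real (len (a [^] n)) \<le> real (len a) * \<bar>real_of_int n\<bar>"
proof -
  have nat_case: "len (a [^] int k) \<le> k * len a" for k
  proof (induction k)
    case (Suc k)
    have "a [^] int (Suc k) = a [^] int k \<otimes> a"
      by (simp only: int_pow_int nat_pow_Suc)
    then show ?case
      using Suc len_mult[of "a [^] int k" a] a by simp
  qed simp
  have "len (a [^] n) = len (a [^] int (nat \<bar>n\<bar>))"
    using a int_pow_neg[OF a, of "- n"] by (cases "n \<ge> 0") auto
  also have "\<dots> \<le> nat \<bar>n\<bar> * len a" by (rule nat_case)
  finally have "real (len (a [^] n)) \<le> real (nat \<bar>n\<bar> * len a)" by (simp only: of_nat_le_iff)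
  then show ?thesis by (simp add: mult.commute)
qed

text \<open>A factorization of \<open>a [^] n\<close> into short elements of \<open>H\<close> is
  brought into normal form factor by factor. Each factor changes the exponent by at most a constant,
  since the change depends only on the current element of \<open>F\<close> and the factor, both from
  finite sets.\<close>

lemma undistorted_powers:
  assumes H: "subgroup H G" and und: "undistorted H"
    and a: "a \<in> H" and F: "finite F" "F \<subseteq> H"
    and nf: "\<And>h. h \<in> H \<Longrightarrow> \<exists>i::int. \<exists>f\<in>F. h = a [^] i \<otimes> f"
    and inj: "inj (\<lambda>i::int. a [^] i)"
  shows "\<exists>c::real. c \<ge> 0 \<and> (\<forall>n::int. \<bar>real_of_int n\<bar> \<le> c * (real (len (a [^] n)) + 1))"
proof -
  note Hc [simp] = subgroup.mem_carrier[OF H]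
  note Hm [simp] = subgroup.m_closed[OF H]
  have ac: "a \<in> carrier G" using a by simp
  have FH [simp]: "f \<in> H" if "f \<in> F" for f using that F(2) by blast
  have powH: "a [^] i \<in> H" for i :: int
    using int_pow_consistent[OF H a, of i] a
      group.int_pow_closed[OF subgroup_imp_group[OF H], of a i] by simp
  obtain R L where RL: "\<And>h. h \<in> H \<Longrightarrow> \<exists>hs. set hs \<subseteq> H \<and> (\<forall>k\<in>set hs. len k \<le> R) \<and>
      length hs \<le> L * len h \<and> word_value G hs = h"
    using und unfolding undistorted_def by blast
  obtain e t where et: "\<And>h. h \<in> H \<Longrightarrow> t h \<in> F \<and> h = a [^] (e h :: int) \<otimes> t h"
    using nf by metis
  define Y where "Y = {y \<in> carrier G. len y \<le> R} \<inter> H"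
  have finI: "finite (insert 0 ((\<lambda>(f, y). \<bar>e (f \<otimes> y)\<bar>) ` (F \<times> Y)))"
    using F(1) finite_ball by (simp add: Y_def)
  define c where "c = Max (insert 0 ((\<lambda>(f, y). \<bar>e (f \<otimes> y)\<bar>) ` (F \<times> Y)))"
  have c: "\<bar>e (f \<otimes> y)\<bar> \<le> c" if "f \<in> F" "y \<in> Y" for f y
    unfolding c_def using that by (intro Max_ge finI) force
  have c0: "c \<ge> 0" unfolding c_def by (intro Max_ge finI) simp
  have words: "\<exists>i f. f \<in> F \<and> word_value G ws = a [^] i \<otimes> f \<and> \<bar>i\<bar> \<le> \<bar>e \<one>\<bar> + c * length ws"
    if "set ws \<subseteq> Y" for ws
    using that
  proof (induction ws rule: rev_induct)
    case Nil
    show ?case using et[OF subgroup.one_closed[OF H]] by (intro exI[of _ "e \<one>"] exI[of _ "t \<one>"]) simp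
  next
    case (snoc y ws)
    then obtain i f where wf: "f \<in> F" "word_value G ws = a [^] i \<otimes> f"
      "\<bar>i\<bar> \<le> \<bar>e \<one>\<bar> + c * length ws" by auto
    have y: "y \<in> Y" "y \<in> H" using snoc.prems by (auto simp: Y_def)
    have s: "set ws \<subseteq> carrier G" "set [y] \<subseteq> carrier G" using snoc.prems by (auto simp: Y_def)
    have fy: "t (f \<otimes> y) \<in> F" "f \<otimes> y = a [^] e (f \<otimes> y) \<otimes> t (f \<otimes> y)"
      using et[of "f \<otimes> y"] wf(1) y by auto
    have "word_value G (ws @ [y]) = a [^] i \<otimes> (f \<otimes> y)"
      using wf(1,2) y ac word_value_append[OF s] by (simp add: m_assoc del: foldr_append)
    also have "\<dots> = a [^] i \<otimes> (a [^] e (f \<otimes> y) \<otimes> t (f \<otimes> y))"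
      using fy(2) by simp
    also have "\<dots> = a [^] (i + e (f \<otimes> y)) \<otimes> t (f \<otimes> y)"
      using fy(1) ac by (simp add: int_pow_mult m_assoc)
    finally have "word_value G (ws @ [y]) = a [^] (i + e (f \<otimes> y)) \<otimes> t (f \<otimes> y)" .
    moreover have "\<bar>i + e (f \<otimes> y)\<bar> \<le> \<bar>e \<one>\<bar> + c * length (ws @ [y])"
      using wf(3) c[OF wf(1) y(1)] by (simp add: algebra_simps)
    ultimately show ?case using fy(1) by blast
  qed
  \<comment> \<open>The exponent obtained for \<open>a [^] n\<close> may differ from
    \<open>n\<close>, but then \<open>a\<close> to the difference lies in \<open>F\<close>; by
    injectivity only finitely many differences occur.\<close>
  define P where "P = {i::int. a [^] i \<in> F}"
  have "finite P"
    using finite_vimageI[OF F(1) inj] by (simp add: P_def vimage_def)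
  define c' where "c' = Max (insert 0 (abs ` P))"
  have c': "\<bar>i\<bar> \<le> c'" if "i \<in> P" for i
    unfolding c'_def using that \<open>finite P\<close> by (intro Max_ge) auto
  have c'0: "c' \<ge> 0" unfolding c'_def using \<open>finite P\<close> by (intro Max_ge) auto
  have main: "\<bar>n\<bar> \<le> (c' + \<bar>e \<one>\<bar> + c * L) * (int (len (a [^] n)) + 1)" for n
  proof -
    obtain hs where hs: "set hs \<subseteq> H" "\<forall>k\<in>set hs. len k \<le> R" "length hs \<le> L * len (a [^] n)"
      "word_value G hs = a [^] n"
      using RL[OF powH[of n]] by blast
    have "set hs \<subseteq> Y" using hs(1,2) by (auto simp: Y_def)
    then obtain i f where wf: "f \<in> F" "a [^] n = a [^] i \<otimes> f" "\<bar>i\<bar> \<le> \<bar>e \<one>\<bar> + c * length hs"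
      using words hs(4) by metis
    have "a [^] (n - i) = f"
      using wf(1,2) ac int_pow_mult[OF ac, of "- i" n]
      by (simp add: int_pow_neg inv_cancel_left)
    then have "\<bar>n - i\<bar> \<le> c'" using wf(1) by (intro c') (simp add: P_def)
    moreover have "c * length hs \<le> c * (L * len (a [^] n))"
      using hs(3) c0 by (intro mult_left_mono) (simp_all flip: of_nat_mult)
    ultimately have "\<bar>n\<bar> \<le> (c' + \<bar>e \<one>\<bar>) + c * L * len (a [^] n)"
      using wf(3) by (simp add: mult.assoc)
    also have "\<dots> \<le> (c' + \<bar>e \<one>\<bar>) * (int (len (a [^] n)) + 1) + c * L * (int (len (a [^] n)) + 1)"
      using c0 c'0 by (intro add_mono mult_left_mono) (auto simp: algebra_simps)
    finally show ?thesis by (simp add: algebra_simps)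
  qed
  show ?thesis
  proof (intro exI[of _ "real_of_int (c' + \<bar>e \<one>\<bar> + c * L)"] conjI allI)
    show "0 \<le> real_of_int (c' + \<bar>e \<one>\<bar> + c * L)" using c0 c'0 by simp
    fix n :: int
    have "real_of_int \<bar>n\<bar> \<le> real_of_int ((c' + \<bar>e \<one>\<bar> + c * L) * (int (len (a [^] n)) + 1))"
      using main by (simp only: of_int_le_iff)
    then show "\<bar>real_of_int n\<bar> \<le> real_of_int (c' + \<bar>e \<one>\<bar> + c * L) * (real (len (a [^] n)) + 1)"
      by simp
  qed
qed

end

section \<open>The virtually cyclic case\<close>

context quasiconvex_with_action
begin

text \<open>By the pigeonhole principle two elements of \<open>conj_inter v\<close> have the same
  part in \<open>F\<close>, and so do their conjugates. Their quotient is a power of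
  \<open>a\<close> whose conjugate is again a power of \<open>a\<close>; applying
  \<open>abs_le_if_no_distortion\<close> in both directions gives exponents of equal absolute
  value.\<close>

lemma conjugate_powers:
  assumes und: "undistorted H" and a: "a \<in> H" and F: "finite F" "F \<subseteq> H"
    and nf: "\<And>h. h \<in> H \<Longrightarrow> \<exists>i::int. \<exists>f\<in>F. h = a [^] i \<otimes> f"
    and v: "v \<in> carrier G" and inf: "infinite (conj_inter v)"
  obtains p q :: int where "q \<noteq> 0" "\<bar>p\<bar> = \<bar>q\<bar>" "a [^] p = v \<otimes> a [^] q \<otimes> inv v"
proof -
  have ac: "a \<in> carrier G" using a by simp
  have FH [simp]: "f \<in> H" if "f \<in> F" for f using that F(2) by blast
  \<comment> \<open>If \<open>a\<close> had finite order, the normal form would leave only finitely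
    many elements in \<open>H\<close>.\<close>
  have inj: "inj (\<lambda>i::int. a [^] i)"
  proof (rule ccontr)
    assume "\<not> ?thesis"
    then have "finite (range (\<lambda>i::int. a [^] i))" by (rule finite_powers_if_not_inj[OF ac])
    then have "finite ((\<lambda>(x, f). x \<otimes> f) ` (range (\<lambda>i::int. a [^] i) \<times> F))" using F(1) by simp
    moreover have "conj_inter v \<subseteq> (\<lambda>(x, f). x \<otimes> f) ` (range (\<lambda>i::int. a [^] i) \<times> F)"
      using nf by (force simp: conj_inter_def)
    ultimately show False using inf finite_subset by blast
  qed
  obtain e t where et: "\<And>h. h \<in> H \<Longrightarrow> t h \<in> F \<and> h = a [^] (e h :: int) \<otimes> t h"
    using nf by metis
  have quot: "x \<otimes> inv y = a [^] (e x - e y)" if "x \<in> H" "y \<in> H" "t x = t y" for x y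
  proof -
    have tc: "t y \<in> carrier G" using et[OF that(2)] by simp
    have "x = a [^] e x \<otimes> t y" "y = a [^] e y \<otimes> t y"
      using et[OF that(1)] et[OF that(2)] that(3) by auto
    then have "x \<otimes> inv y = (a [^] e x \<otimes> t y) \<otimes> inv (a [^] e y \<otimes> t y)"
      by simp
    then show ?thesis
      using ac tc by (simp add: int_pow_diff group_normalize)
  qed
  define c where "c h = inv v \<otimes> h \<otimes> v" for h
  have cH: "h \<in> H" "c h \<in> H" if "h \<in> conj_inter v" for h
    using that by (auto simp: conj_inter_def c_def)
  let ?T = "\<lambda>h. (t h, t (c h))"
  have "?T ` conj_inter v \<subseteq> F \<times> F" using et cH by auto
  then have "finite (?T ` conj_inter v)" using F(1) finite_subset by blast
  from pigeonhole_infinite[OF inf this] obtain x where x: "x \<in> conj_inter v"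
    and fiber: "infinite {h \<in> conj_inter v. ?T h = ?T x}" by blast
  have "{h \<in> conj_inter v. ?T h = ?T x} - {x} \<noteq> {}"
    using infinite_remove[OF fiber, of x] by (metis finite.emptyI)
  then obtain y where y: "y \<in> conj_inter v" "?T y = ?T x" "y \<noteq> x" by auto
  have xy: "x \<in> carrier G" "y \<in> carrier G" using cH x y(1) by simp_all
  define p q where "p = e y - e x" and "q = e (c y) - e (c x)"
  have p: "a [^] p = y \<otimes> inv x"
    using quot[of y x] cH x y by (simp add: p_def)
  have "a [^] q = c y \<otimes> inv (c x)"
    using quot[of "c y" "c x"] cH x y by (simp add: q_def)
  also have "\<dots> = inv v \<otimes> a [^] p \<otimes> v"
    unfolding p using v xy by (simp add: c_def group_normalize)
  finally have q: "a [^] q = inv v \<otimes> a [^] p \<otimes> v" .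
  then have pq: "a [^] p = v \<otimes> a [^] q \<otimes> inv v"
    using v ac by (simp add: group_normalize)
  have p0: "p \<noteq> 0"
  proof
    assume "p = 0"
    then have "y \<otimes> inv x = \<one>" using p by simp
    then show False using y(3) xy by (metis inv_equality inv_inv inv_closed)
  qed
  have q0: "q \<noteq> 0"
  proof
    assume "q = 0"
    then have "a [^] p = a [^] (0::int)" using pq v by simp
    then show False using p0 injD[OF inj] by blast
  qed
  obtain C :: real where C: "C \<ge> 0" "\<And>n::int. \<bar>real_of_int n\<bar> \<le> C * (real (len (a [^] n)) + 1)"
    using undistorted_powers[OF subgroup_H und a F nf inj] by blast
  have conj_le: "len (w \<otimes> z \<otimes> inv w) \<le> len z + 2 * len w" if "w \<in> carrier G" "z \<in> carrier G" for w z
    using len_mult[of "w \<otimes> z" "inv w"] len_mult[of w z] that by simp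
  have "len (a [^] (p * m)) \<le> len (a [^] (q * m)) + 2 * len v" for m
  proof -
    have "a [^] (p * m) = v \<otimes> a [^] (q * m) \<otimes> inv v"
      using conjugate_int_pow[of v "a [^] q" m] v ac by (simp add: int_pow_pow flip: pq)
    then show ?thesis using conj_le[of v "a [^] (q * m)"] v ac by simp
  qed
  then have "real (len (a [^] (p * m))) \<le> len (a [^] (q * m)) + real (2 * len v)" for m
    by (simp only: of_nat_le_iff flip: of_nat_add)
  then have 1: "\<bar>p\<bar> \<le> \<bar>q\<bar>"
    using q0 ac
    by (intro abs_le_if_no_distortion[OF _ _ C(2,1) len_int_pow_le[of a]]) auto
  have "len (a [^] (q * m)) \<le> len (a [^] (p * m)) + 2 * len v" for m
  proof -
    have "a [^] (q * m) = inv v \<otimes> a [^] (p * m) \<otimes> inv (inv v)"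
      using conjugate_int_pow[of "inv v" "a [^] p" m] v ac by (simp add: int_pow_pow flip: q)
    then show ?thesis using conj_le[of "inv v" "a [^] (p * m)"] v ac by simp
  qed
  then have "real (len (a [^] (q * m))) \<le> len (a [^] (p * m)) + real (2 * len v)" for m
    by (simp only: of_nat_le_iff flip: of_nat_add)
  then have 2: "\<bar>q\<bar> \<le> \<bar>p\<bar>"
    using p0 ac
    by (intro abs_le_if_no_distortion[OF _ _ C(2,1) len_int_pow_le[of a]]) auto
  show ?thesis
    using that[OF q0 _ pq] 1 2 by simp
qed

text \<open>For \<open>h = a [^] (q * j) \<otimes> f\<close> one has
  \<open>v \<otimes> h = a [^] (p * j) \<otimes> (v \<otimes> f)\<close>, so
  \<open>\<sigma> (v \<otimes> h)\<close> stays near the orbit point of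
  \<open>a [^] (p * j)\<close>. Distances between orbit points of powers depend only on the absolute
  difference of exponents, and \<open>p\<close> and \<open>q\<close> agree up to sign.\<close>

lemma extension_if_virtually_cyclic:
  assumes vc: "virtually_cyclic (G\<lparr>carrier := H\<rparr>)"
  shows "\<exists>(S :: ('a \<times> 'r) set) dS \<psi>. is_extension G H R dR \<phi> S dS \<psi>"
proof (rule extension_if_parallel_cosets)
  fix v assume v: "v \<in> carrier G" and inf: "infinite (conj_inter v)"
  have und: "undistorted H"
    by (rule geodesically_quasiconvex_imp_undistorted[OF subgroup_H quasiconvex_H])
  obtain a F where a: "a \<in> H" and F: "finite F" "F \<subseteq> H"
    and nf: "\<And>h. h \<in> H \<Longrightarrow> \<exists>i::int. \<exists>f\<in>F. h = a [^] i \<otimes> f"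
    by (rule virtually_cyclic_subgroup_normal_form[OF subgroup_H vc]) (rule that)
  obtain p q :: int where q0: "q \<noteq> 0" and abs: "\<bar>p\<bar> = \<bar>q\<bar>" and pq: "a [^] p = v \<otimes> a [^] q \<otimes> inv v"
    by (rule conjugate_powers[OF und a F nf v inf]) (assumption, rule that)
  have ac: "a \<in> carrier G" using a by simp
  have powH [simp]: "a [^] i \<in> H" for i :: int
    using int_pow_consistent[OF subgroup_H a, of i] a
      group.int_pow_closed[OF subgroup_imp_group[OF subgroup_H], of a i] by simp
  \<comment> \<open>The enlarged finite set absorbs remainders modulo \<open>q\<close>; the interval
    is symmetric because \<open>i mod q\<close> takes the sign of \<open>q\<close>.\<close>
  define F' where "F' = (\<lambda>(r, f). a [^] r \<otimes> f) ` ({- \<bar>q\<bar>..\<bar>q\<bar>} \<times> F)"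
  have F': "finite F'" using F(1) by (simp add: F'_def)
  have F'H [simp]: "f \<in> H" if "f \<in> F'" for f using that F(2) by (auto simp: F'_def)
  have decomp: "\<exists>j f. f \<in> F' \<and> h = a [^] (q * j) \<otimes> f" if h: "h \<in> H" for h
  proof -
    obtain i :: int and f where f: "f \<in> F" "h = a [^] i \<otimes> f" using nf[OF h] by blast
    have fH: "f \<in> H" using f(1) F(2) by blast
    have "a [^] i = a [^] (q * (i div q) + i mod q)" by simp
    then have "h = a [^] (q * (i div q)) \<otimes> (a [^] (i mod q) \<otimes> f)"
      using ac fH by (simp only: f(2) int_pow_mult m_assoc int_pow_closed H_carrier)
    moreover have "\<bar>i mod q\<bar> \<le> \<bar>q\<bar>" using abs_mod_less[OF q0, of i] by simp
    then have "a [^] (i mod q) \<otimes> f \<in> F'"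
      unfolding F'_def using f(1) by (intro image_eqI[of _ _ "(i mod q, f)"]) auto
    ultimately show ?thesis by blast
  qed
  obtain \<gamma> where \<gamma>: "\<gamma> \<ge> 0" "\<And>b y. b \<in> H \<Longrightarrow> y \<in> carrier G \<Longrightarrow> dR (\<phi> b (\<sigma> y)) (\<sigma> (b \<otimes> y)) \<le> \<gamma>"
    by (rule sigma_translate) (rule that)
  define M where "M = Max (insert 0 ((\<lambda>f. dR (\<sigma> (v \<otimes> f)) r0) ` F'))"
  have M: "dR (\<sigma> (v \<otimes> f)) r0 \<le> M" if "f \<in> F'" for f
    unfolding M_def using that F' by (intro Max_ge) auto
  define M' where "M' = Max (insert 0 ((\<lambda>f. dR (orb f) r0) ` F'))"
  have M': "dR (orb f) r0 \<le> M'" if "f \<in> F'" for f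
    unfolding M'_def using that F' by (intro Max_ge) auto
  have near: "dR (\<sigma> (v \<otimes> (a [^] (q * j) \<otimes> f))) (orb (a [^] (p * j))) \<le> \<gamma> + M"
    "dR (orb (a [^] (q * j) \<otimes> f)) (orb (a [^] (q * j))) \<le> M'" if f: "f \<in> F'" for j f
  proof -
    have "a [^] (p * j) = v \<otimes> a [^] (q * j) \<otimes> inv v"
      using conjugate_int_pow[of v "a [^] q" j] v ac by (simp add: int_pow_pow flip: pq)
    then have "v \<otimes> (a [^] (q * j) \<otimes> f) = a [^] (p * j) \<otimes> (v \<otimes> f)"
      using v ac f by (simp add: group_normalize)
    then have "dR (\<phi> (a [^] (p * j)) (\<sigma> (v \<otimes> f))) (\<sigma> (v \<otimes> (a [^] (q * j) \<otimes> f))) \<le> \<gamma>"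
      using \<gamma>(2)[of "a [^] (p * j)" "v \<otimes> f"] v f by simp
    moreover have "dR (\<phi> (a [^] (p * j)) (\<sigma> (v \<otimes> f))) (orb (a [^] (p * j))) \<le> M"
      using M[OF f] r0 by (simp add: phi_isometry)
    ultimately show "dR (\<sigma> (v \<otimes> (a [^] (q * j) \<otimes> f))) (orb (a [^] (p * j))) \<le> \<gamma> + M"
      using R.triangle[of "\<sigma> (v \<otimes> (a [^] (q * j) \<otimes> f))" "\<phi> (a [^] (p * j)) (\<sigma> (v \<otimes> f))"
          "orb (a [^] (p * j))"] r0 R.commute[of "\<sigma> (v \<otimes> (a [^] (q * j) \<otimes> f))"] by simp
    show "dR (orb (a [^] (q * j) \<otimes> f)) (orb (a [^] (q * j))) \<le> M'"
      using M'[OF f] f r0 by (simp add: phi_mult phi_isometry)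
  qed
  have orb_pow: "dR (orb (a [^] x)) (orb (a [^] y)) = dR r0 (orb (a [^] \<bar>x - y\<bar>))" for x y :: int
  proof (cases "x \<le> y")
    case True
    have "inv (a [^] x) \<otimes> a [^] y = a [^] (y - x)"
      using int_pow_mult[OF ac, of "- x" y] ac by (simp add: int_pow_neg)
    then show ?thesis using True orb_dist[of "a [^] x" "a [^] y"] by simp
  next
    case False
    have "inv (a [^] y) \<otimes> a [^] x = a [^] (x - y)"
      using int_pow_mult[OF ac, of "- y" x] ac by (simp add: int_pow_neg)
    then show ?thesis
      using False orb_dist[of "a [^] y" "a [^] x"] R.commute[of "orb (a [^] x)"] by simp
  qed
  have abs_eq: "\<bar>p * j - p * j'\<bar> = \<bar>q * j - q * j'\<bar>" for j j' :: int
    using abs by (simp add: abs_mult flip: right_diff_distrib)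
  have parallel: "dR (orb (a [^] (p * j))) (orb (a [^] (p * j'))) = dR (orb (a [^] (q * j))) (orb (a [^] (q * j')))"
    for j j' by (simp only: orb_pow abs_eq)
  show "\<exists>\<kappa>. \<forall>h\<in>H. \<forall>h'\<in>H. dR (\<sigma> (v \<otimes> h)) (\<sigma> (v \<otimes> h')) \<le> \<kappa> + dR (orb h) (orb h')"
  proof (intro exI[of _ "2 * (\<gamma> + M) + 2 * M'"] ballI)
    fix h h' assume hh: "h \<in> H" "h' \<in> H"
    obtain j f where f: "f \<in> F'" "h = a [^] (q * j) \<otimes> f" using decomp[OF hh(1)] by blast
    obtain j' f' where f': "f' \<in> F'" "h' = a [^] (q * j') \<otimes> f'" using decomp[OF hh(2)] by blast
    let ?s = "\<sigma> (v \<otimes> h)" and ?s' = "\<sigma> (v \<otimes> h')"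
    let ?p = "orb (a [^] (p * j))" and ?p' = "orb (a [^] (p * j'))"
    let ?q = "orb (a [^] (q * j))" and ?q' = "orb (a [^] (q * j'))"
    note n = near[OF f(1), of j, folded f(2)] and n' = near[OF f'(1), of j', folded f'(2)]
    have mem: "?s \<in> R" "?s' \<in> R" "?p \<in> R" "?p' \<in> R" "?q \<in> R" "?q' \<in> R" "orb h \<in> R" "orb h' \<in> R"
      using hh r0 by simp_all
    \<comment> \<open>The final estimate for plain real numbers: two triangle inequalities joined by
      the equality of their middle terms.\<close>
    have add: "s \<le> 2 * c + 2 * e + t" if "s \<le> x + (y + x')" "y = u" "u \<le> z + (t + z')"
      "x \<le> c" "x' \<le> c" "z \<le> e" "z' \<le> e" for s c e t x x' y u z z' :: real
      using that by linarith
    have 1: "dR ?s ?s' \<le> dR ?s ?p + (dR ?p ?p' + dR ?s' ?p')"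
      using R.triangle[OF mem(1,3,2)] R.triangle[OF mem(3,4,2)] R.commute[of ?s' ?p'] by linarith
    have 2: "dR ?q ?q' \<le> dR (orb h) ?q + (dR (orb h) (orb h') + dR (orb h') ?q')"
      using R.triangle[OF mem(5,7,6)] R.triangle[OF mem(7,8,6)] R.commute[of ?q "orb h"] by linarith
    show "dR ?s ?s' \<le> 2 * (\<gamma> + M) + 2 * M' + dR (orb h) (orb h')"
      by (rule add[OF 1 parallel 2 n(1) n'(1) n(2) n'(2)])
  qed
qed

end

text \<open>An empty \<open>R\<close> has no base point for an orbit map; the empty action of
  \<open>G\<close> then serves.\<close>

lemma extension_of_empty_action:
  fixes G :: "('g, 'm) monoid_scheme" and R :: "'r set"
  assumes "group G" and "R = {}"
  shows "\<exists>(S :: ('g \<times> 'r) set) dS \<psi>. is_extension G H R dR \<phi> S dS \<psi>"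
proof -
  have "isometric_action G (carrier G \<times> R)
      (\<lambda>x y. if x = y \<or> x \<notin> carrier G \<times> R \<or> y \<notin> carrier G \<times> R then 0 else 1 + (0::real))
      (\<lambda>g. \<lambda>x\<in>carrier G \<times> R. (g \<otimes>\<^bsub>G\<^esub> fst x, snd x))"
    by (rule isometric_action_on_product) (use assms in auto)
  moreover have "quasi_isometric_embedding R dR S dS f" "coarsely_equivariant H R \<phi> dS \<psi> f"
    for S :: "('g \<times> 'r) set" and dS \<psi> f
    using assms(2) by (auto simp: quasi_isometric_embedding_def coarsely_equivariant_def intro!: exI[of _ 1])
  ultimately show ?thesis
    unfolding is_extension_def by blast
qed

theorem corollary1p9:
  fixes G :: "('g, 'm) monoid_scheme" and H :: "'g set"
  assumes "hyperbolic_group G" and "subgroup H G"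
  shows "(quasiconvex_subgroup G H \<and>
            (virtually_cyclic (G\<lparr>carrier := H\<rparr>) \<or> almost_malnormal G H)
          \<longrightarrow> extension_problem_solvable TYPE('r) G H) \<and>
         (extension_problem_solvable TYPE('g) G H \<longrightarrow> quasiconvex_subgroup G H)"
proof -
  interpret group G using assms(1) by (simp add: hyperbolic_group_def)
  obtain X where X: "finite_generating_set G X" and hyp: "gromov_hyperbolic (carrier G) (word_dist G X)"
    using assms(1) by (auto simp: hyperbolic_group_def)
  obtain \<delta> where \<delta>: "\<And>w x y z. w \<in> carrier G \<Longrightarrow> x \<in> carrier G \<Longrightarrow> y \<in> carrier G \<Longrightarrow> z \<in> carrier G \<Longrightarrow>
      gromov_product (word_dist G X) w x z
        \<ge> min (gromov_product (word_dist G X) w x y) (gromov_product (word_dist G X) w y z) - \<delta>"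
    using hyp unfolding gromov_hyperbolic_def by blast
  \<comment> \<open>The definition of hyperbolicity fixes no sign for \<open>\<delta>\<close>,
    whereas the locale requires a nonnegative constant.\<close>
  interpret hyperbolic_generated_group G X "max \<delta> 0"
  proof unfold_locales
    fix w x y z assume "w \<in> carrier G" "x \<in> carrier G" "y \<in> carrier G" "z \<in> carrier G"
    from \<delta>[OF this] show "gromov_product (word_dist G X) w x z
        \<ge> min (gromov_product (word_dist G X) w x y) (gromov_product (word_dist G X) w y z) - max \<delta> 0"
      by linarith
  qed (use X in auto)
  show ?thesis
  proof (intro conjI impI)
    assume "extension_problem_solvable TYPE('g) G H"
    then have "undistorted H" by (rule extension_solvable_imp_undistorted[OF assms(2)])
    from undistorted_imp_geodesically_quasiconvex[OF assms(2) this]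
    show "quasiconvex_subgroup G H"
      using X assms(2) unfolding quasiconvex_subgroup_def geodesically_quasiconvex_def by blast
  next
    assume *: "quasiconvex_subgroup G H \<and>
      (virtually_cyclic (G\<lparr>carrier := H\<rparr>) \<or> almost_malnormal G H)"
    then obtain X' K' where X': "finite_generating_set G X'"
      and K': "\<forall>n p. cayley_geodesic G X' n p \<and> p 0 \<in> H \<and> p n \<in> H \<longrightarrow>
                (\<forall>i\<le>n. \<exists>h\<in>H. word_dist G X' (p i) h \<le> K')"
      unfolding quasiconvex_subgroup_def by blast
    \<comment> \<open>Quasiconvexity may be witnessed by another generating set than hyperbolicity;
      undistortedness carries it from \<open>X'\<close> to \<open>X\<close>.\<close>
    interpret X': generated_group G X' by unfold_locales (rule X')
    have "X'.undistorted H"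
      by (rule X'.geodesically_quasiconvex_imp_undistorted[OF assms(2)])
        (rule K'[folded X'.geodesically_quasiconvex_def])
    then have "undistorted H"
      by (rule undistorted_change_of_generators[OF X' subgroup.subset[OF assms(2)]])
    then obtain K where K: "geodesically_quasiconvex H K"
      using undistorted_imp_geodesically_quasiconvex[OF assms(2)] by blast
    show "extension_problem_solvable TYPE('r) G H"
      unfolding extension_problem_solvable_def
    proof (intro allI impI)
      fix R :: "'r set" and dR \<phi>
      assume act: "isometric_action (G\<lparr>carrier := H\<rparr>) R dR \<phi>"
      show "\<exists>(S :: ('g \<times> 'r) set) dS \<psi>. is_extension G H R dR \<phi> S dS \<psi>"
      proof (cases "R = {}")
        case True
        then show ?thesis by (rule extension_of_empty_action[OF group_axioms])
      next
        case False
        then obtain r0 where "r0 \<in> R" by auto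
        interpret quasiconvex_with_action G X "max \<delta> 0" H K R dR \<phi> r0
          by (intro quasiconvex_with_action.intro quasiconvex_in_hyperbolic.intro
              quasiconvex_with_action_axioms.intro quasiconvex_in_hyperbolic_axioms.intro
              hyperbolic_generated_group_axioms assms(2) K act \<open>r0 \<in> R\<close>)
        show ?thesis
          using * extension_if_virtually_cyclic extension_if_almost_malnormal by blast
      qed
    qed
  qed
qed

end
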